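(* Let $X$ be the cylinder, i.e. the quotient of $[0,1]\times[0,1]$ by the identifications $(0,y)\sim(1,y)$ for $y\in[0,1]$, and let $Y$ be the M\"obius strip, i.e. the quotient of $[0,1]\times[0,1]$ by the identifications $(0,y)\sim(1,1-y)$ for $y\in[0,1]$. Let $C(X)$ and $C(Y)$ be the $\mathbb{C}$-algebras of continuous complex-valued functions on $X$ and $Y$. Then the algebras $C(X)$ and $C(Y)$ are not isomorphic as $\mathbb{C}$-algebras, but their Loday functors $\mathcal{L}_{C(X)}$ and $\mathcal{L}_{C(Y)}$ are (naturally) isomorphic as functors $\Omega\to \mathrm{Vect}_{\mathbb{C}}$.
   Context: $\mathbb{N}=\{1,2,\dots\}$. $\Omega$ is the category whose objects are the sets $\langle n\rangle=\{1,\dots,n\}$, $n\in\mathbb{N}$, and whose morphisms are surjective maps. $\mathrm{Vect}_{\mathbb{C}}$ is the category of complex vector spaces and linear maps. For a commutative (not necessarily unital) $\mathbb{C}$-algebra $A$, the Loday functor $\mathcal{L}_A:\Omega\to\mathrm{Vect}_{\mathbb{C}}$ takes $\langle n\rangle$ to the algebraic tensor power $A^{\otimes n}$ over $\mathbb{C}$ and a surjection $\sigma:\langle n\rangle\to\langle m\rangle$ to the linear map $\sigma^*:A^{\otimes n}\to A^{\otimes m}$, $a_1\otimes\dots\otimes a_n\mapsto b_1\otimes\dots\otimes b_m$, where $b_j=\prod_{i\in\sigma^{-1}(j)}a_i$. *)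

theory Defs
  imports "HOL-Analysis.Analysis" "HOL-Algebra.Algebraic_Closure_Type" "HOL-Library.Poly_Mapping"
begin

section \<open>Vector spaces and algebras over the complex numbers\<close>

text \<open>
  Vector spaces are modules in the sense of HOL-Algebra over the field of complex numbers.  The
  fields \<open>mult\<close> and \<open>one\<close> of a \<open>module\<close> record play no role when it stands for a vector space, and
  \<open>one\<close> plays no role when it stands for a not necessarily unital algebra.
\<close>

abbreviation complex_ring :: "complex ring" where
  "complex_ring \<equiv> ring_of_type_algebra"

definition linear_maps :: "(complex, 'v) module \<Rightarrow> (complex, 'w) module \<Rightarrow> ('v \<Rightarrow> 'w) set" where
  "linear_maps V W = {f \<in> carrier V \<rightarrow> carrier W.
     (\<forall>u\<in>carrier V. \<forall>v\<in>carrier V. f (u \<oplus>\<^bsub>V\<^esub> v) = f u \<oplus>\<^bsub>W\<^esub> f v) \<and>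
     (\<forall>c. \<forall>v\<in>carrier V. f (c \<odot>\<^bsub>V\<^esub> v) = c \<odot>\<^bsub>W\<^esub> f v)}"

definition linear_isos :: "(complex, 'v) module \<Rightarrow> (complex, 'w) module \<Rightarrow> ('v \<Rightarrow> 'w) set" where
  "linear_isos V W = {f \<in> linear_maps V W. bij_betw f (carrier V) (carrier W)}"

text \<open>
  Preservation of units is not required here, but it is automatic for a surjective multiplicative
  map between unital algebras.
\<close>

definition algebras_isomorphic :: "(complex, 'a) module \<Rightarrow> (complex, 'b) module \<Rightarrow> bool" where
  "algebras_isomorphic A B \<longleftrightarrow> (\<exists>f\<in>linear_isos A B.
     \<forall>x\<in>carrier A. \<forall>y\<in>carrier A. f (x \<otimes>\<^bsub>A\<^esub> y) = f x \<otimes>\<^bsub>B\<^esub> f y)"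


section \<open>Functors from the category of finite sets and surjections\<close>

definition surjections :: "nat \<Rightarrow> nat \<Rightarrow> (nat \<Rightarrow> nat) set" where
  "surjections n m = {\<sigma> \<in> {1..n} \<rightarrow>\<^sub>E {1..m}. \<sigma> ` {1..n} = {1..m}}"

record 'v omega_functor =
  obj :: "nat \<Rightarrow> (complex, 'v) module"
  arr :: "nat \<Rightarrow> nat \<Rightarrow> (nat \<Rightarrow> nat) \<Rightarrow> 'v \<Rightarrow> 'v"

text \<open>
  Only the values of \<open>obj F\<close> at positive arguments matter, and \<open>arr F n m \<sigma>\<close> matters only as a map
  on \<open>carrier (obj F n)\<close>, for \<open>\<sigma>\<close> in \<open>surjections n m\<close> with \<open>n\<close> and \<open>m\<close> positive.
\<close>

definition is_omega_functor :: "'v omega_functor \<Rightarrow> bool" where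
  "is_omega_functor F \<longleftrightarrow>
     (\<forall>n\<ge>1. module complex_ring (obj F n)) \<and>
     (\<forall>n\<ge>1. \<forall>m\<ge>1. \<forall>\<sigma>\<in>surjections n m. arr F n m \<sigma> \<in> linear_maps (obj F n) (obj F m)) \<and>
     (\<forall>n\<ge>1. \<forall>v\<in>carrier (obj F n). arr F n n (\<lambda>i\<in>{1..n}. i) v = v) \<and>
     (\<forall>n\<ge>1. \<forall>m\<ge>1. \<forall>l\<ge>1. \<forall>\<sigma>\<in>surjections n m. \<forall>\<tau>\<in>surjections m l. \<forall>v\<in>carrier (obj F n).
        arr F n l (compose {1..n} \<tau> \<sigma>) v = arr F m l \<tau> (arr F n m \<sigma> v))"

definition naturally_isomorphic :: "'v omega_functor \<Rightarrow> 'w omega_functor \<Rightarrow> bool" where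
  "naturally_isomorphic F G \<longleftrightarrow> is_omega_functor F \<and> is_omega_functor G \<and>
     (\<exists>\<eta>. (\<forall>n\<ge>1. \<eta> n \<in> linear_isos (obj F n) (obj G n)) \<and>
          (\<forall>n\<ge>1. \<forall>m\<ge>1. \<forall>\<sigma>\<in>surjections n m. \<forall>v\<in>carrier (obj F n).
             \<eta> m (arr F n m \<sigma> v) = arr G n m \<sigma> (\<eta> n v)))"


section \<open>Tensor powers\<close>

text \<open>
  The tensor power of \<open>A\<close> is the free vector space on the set of families \<open>{1..n} \<rightarrow>\<^sub>E carrier A\<close>
  modulo the span of the multilinearity relations; its elements are the cosets.  The basis vector
  \<open>Poly_Mapping.single a 1\<close> stands for the pure tensor of the family \<open>a\<close>.
\<close>

definition pm_scale :: "complex \<Rightarrow> ('k \<Rightarrow>\<^sub>0 complex) \<Rightarrow> 'k \<Rightarrow>\<^sub>0 complex" where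
  "pm_scale c p = Poly_Mapping.map ((*) c) p"

lemma lookup_pm_scale [simp]: "Poly_Mapping.lookup (pm_scale c p) k = c * Poly_Mapping.lookup p k"
  by (simp add: pm_scale_def Poly_Mapping.map.rep_eq when_def)

global_interpretation pm: vector_space pm_scale
  defines pm_span = pm.span
  by unfold_locales
     (auto intro!: poly_mapping_eqI simp: lookup_add algebra_simps)

definition pm_extend :: "('k \<Rightarrow> 'l) \<Rightarrow> ('k \<Rightarrow>\<^sub>0 complex) \<Rightarrow> 'l \<Rightarrow>\<^sub>0 complex" where
  "pm_extend g p = (\<Sum>k\<in>Poly_Mapping.keys p. Poly_Mapping.single (g k) (Poly_Mapping.lookup p k))"

definition free_vectors :: "(complex, 'a) module \<Rightarrow> nat \<Rightarrow> ((nat \<Rightarrow> 'a) \<Rightarrow>\<^sub>0 complex) set" where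
  "free_vectors A n = {p. Poly_Mapping.keys p \<subseteq> ({1..n} \<rightarrow>\<^sub>E carrier A)}"

definition multilinearity_relations ::
    "(complex, 'a) module \<Rightarrow> nat \<Rightarrow> ((nat \<Rightarrow> 'a) \<Rightarrow>\<^sub>0 complex) set" where
  "multilinearity_relations A n =
     {Poly_Mapping.single (a(i := x \<oplus>\<^bsub>A\<^esub> y)) 1
        - (Poly_Mapping.single (a(i := x)) 1 + Poly_Mapping.single (a(i := y)) 1) | a i x y.
        a \<in> {1..n} \<rightarrow>\<^sub>E carrier A \<and> i \<in> {1..n} \<and> x \<in> carrier A \<and> y \<in> carrier A} \<union>
     {Poly_Mapping.single (a(i := c \<odot>\<^bsub>A\<^esub> x)) 1 - pm_scale c (Poly_Mapping.single (a(i := x)) 1)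
        | a i c x. a \<in> {1..n} \<rightarrow>\<^sub>E carrier A \<and> i \<in> {1..n} \<and> x \<in> carrier A}"

definition tensor_class :: "(complex, 'a) module \<Rightarrow> nat \<Rightarrow>
    ((nat \<Rightarrow> 'a) \<Rightarrow>\<^sub>0 complex) \<Rightarrow> ((nat \<Rightarrow> 'a) \<Rightarrow>\<^sub>0 complex) set" where
  "tensor_class A n p = {q. q - p \<in> pm_span (multilinearity_relations A n)}"

definition tensor_power :: "(complex, 'a) module \<Rightarrow> nat \<Rightarrow>
    (complex, ((nat \<Rightarrow> 'a) \<Rightarrow>\<^sub>0 complex) set) module" where
  "tensor_power A n =
     \<lparr>carrier = tensor_class A n ` free_vectors A n,
      mult = undefined,
      one = undefined,
      zero = tensor_class A n 0,
      add = (\<lambda>U V. \<Union>u\<in>U. \<Union>v\<in>V. tensor_class A n (u + v)),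
      smult = (\<lambda>c U. \<Union>u\<in>U. tensor_class A n (pm_scale c u))\<rparr>"


section \<open>The Loday functor\<close>

text \<open>
  The product of a family over a finite nonempty set of indices, formed without using a unit.
\<close>

definition fibre_prod :: "(complex, 'a) module \<Rightarrow> (nat \<Rightarrow> 'a) \<Rightarrow> nat set \<Rightarrow> 'a" where
  "fibre_prod A a S = foldl (mult A) (a (Min S)) (map a (sorted_list_of_set (S - {Min S})))"

definition fibre_prods ::
    "(complex, 'a) module \<Rightarrow> nat \<Rightarrow> nat \<Rightarrow> (nat \<Rightarrow> nat) \<Rightarrow> (nat \<Rightarrow> 'a) \<Rightarrow> nat \<Rightarrow> 'a" where
  "fibre_prods A n m \<sigma> a = (\<lambda>j\<in>{1..m}. fibre_prod A a {i \<in> {1..n}. \<sigma> i = j})"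

definition loday :: "(complex, 'a) module \<Rightarrow> ((nat \<Rightarrow> 'a) \<Rightarrow>\<^sub>0 complex) set omega_functor" where
  "loday A =
     \<lparr>obj = tensor_power A,
      arr = (\<lambda>n m \<sigma> U. \<Union>u\<in>U. tensor_class A m (pm_extend (fibre_prods A n m \<sigma>) u))\<rparr>"

lemma fibre_prod_eq_finprod:
  assumes "comm_monoid A" "finite S" "S \<noteq> {}" "a \<in> S \<rightarrow> carrier A"
  shows "fibre_prod A a S = finprod A a S"
proof -
  interpret comm_monoid A by fact
  have *: "x \<in> carrier A \<Longrightarrow> distinct xs \<Longrightarrow> a \<in> set xs \<rightarrow> carrier A \<Longrightarrow>
      foldl (mult A) x (map a xs) = x \<otimes>\<^bsub>A\<^esub> finprod A a (set xs)" for x xs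
    by (induction xs arbitrary: x) (auto simp: Pi_def m_assoc)
  have m: "Min S \<in> S" using assms by simp
  have "fibre_prod A a S = a (Min S) \<otimes>\<^bsub>A\<^esub> finprod A a (S - {Min S})"
    unfolding fibre_prod_def using assms m by (subst *) (auto simp: Pi_def)
  also have "\<dots> = finprod A a (insert (Min S) (S - {Min S}))"
    using assms m by (subst finprod_insert) (auto simp: Pi_def)
  also have "insert (Min S) (S - {Min S}) = S" using m by auto
  finally show ?thesis .
qed


section \<open>Algebras of continuous functions\<close>

definition continuous_functions :: "'p topology \<Rightarrow> (complex, 'p \<Rightarrow> complex) module" where
  "continuous_functions T =
     \<lparr>carrier = {f \<in> extensional (topspace T). continuous_map T euclidean f},
      mult = (\<lambda>f g. \<lambda>x\<in>topspace T. f x * g x),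
      one = (\<lambda>x\<in>topspace T. 1),
      zero = (\<lambda>x\<in>topspace T. 0),
      add = (\<lambda>f g. \<lambda>x\<in>topspace T. f x + g x),
      smult = (\<lambda>c f. \<lambda>x\<in>topspace T. c * f x)\<rparr>"

lemma continuous_map_restrict_topspace [simp]:
  "continuous_map T S (\<lambda>x\<in>topspace T. f x) \<longleftrightarrow> continuous_map T S f"
  by (metis continuous_map_eq restrict_apply')

lemma continuous_map_complex_mult:
  fixes f g :: "'p \<Rightarrow> complex"
  shows "continuous_map T euclidean f \<Longrightarrow> continuous_map T euclidean g \<Longrightarrow>
    continuous_map T euclidean (\<lambda>x. f x * g x)"
  by (simp add: continuous_map_atin tendsto_mult)

lemma algebra_continuous_functions: "algebra complex_ring (continuous_functions T)"
proof (rule algebraI)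
  show "cring complex_ring"
    by (rule cring_from_type_algebra)
  show "cring (continuous_functions T)"
  proof (rule cringI)
    show "abelian_group (continuous_functions T)"
    proof (rule abelian_groupI)
      fix f assume "f \<in> carrier (continuous_functions T)"
      then show "\<exists>g\<in>carrier (continuous_functions T).
          g \<oplus>\<^bsub>continuous_functions T\<^esub> f = \<zero>\<^bsub>continuous_functions T\<^esub>"
        by (intro bexI[of _ "\<lambda>x\<in>topspace T. - f x"])
           (auto simp: continuous_functions_def fun_eq_iff)
    qed (auto simp: continuous_functions_def fun_eq_iff extensional_def algebra_simps
        intro!: continuous_map_add)
    show "Group.comm_monoid (continuous_functions T)"
      by (rule comm_monoidI)
         (auto simp: continuous_functions_def fun_eq_iff extensional_def algebra_simps
           intro!: continuous_map_complex_mult)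
  qed (auto simp: continuous_functions_def fun_eq_iff extensional_def algebra_simps)
qed (auto simp: continuous_functions_def ring_of_type_algebra_def fun_eq_iff extensional_def
    algebra_simps intro!: continuous_map_complex_mult)


section \<open>Quotient spaces\<close>

definition quotient_class :: "'p topology \<Rightarrow> ('p \<Rightarrow> 'p \<Rightarrow> bool) \<Rightarrow> 'p \<Rightarrow> 'p set" where
  "quotient_class T r x = {y \<in> topspace T. equivclp r x y}"

definition quotient_space :: "'p topology \<Rightarrow> ('p \<Rightarrow> 'p \<Rightarrow> bool) \<Rightarrow> 'p set topology" where
  "quotient_space T r = topology (\<lambda>U. U \<subseteq> quotient_class T r ` topspace T \<and>
     openin T {x \<in> topspace T. quotient_class T r x \<in> U})"

lemma openin_quotient_space:
  "openin (quotient_space T r) U \<longleftrightarrow> U \<subseteq> quotient_class T r ` topspace T \<and>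
     openin T {x \<in> topspace T. quotient_class T r x \<in> U}"
proof -
  let ?c = "quotient_class T r"
  let ?P = "\<lambda>U. U \<subseteq> ?c ` topspace T \<and> openin T {x \<in> topspace T. ?c x \<in> U}"
  have "istopology ?P"
    unfolding istopology_def
  proof safe
    fix U V assume "openin T {x \<in> topspace T. ?c x \<in> U}" "openin T {x \<in> topspace T. ?c x \<in> V}"
    from openin_Int[OF this] show "openin T {x \<in> topspace T. ?c x \<in> U \<inter> V}"
      by (rule back_subst[where P = "openin T"]) auto
  next
    fix \<K> assume "\<forall>K\<in>\<K>. ?P K"
    then have "openin T (\<Union>K\<in>\<K>. {x \<in> topspace T. ?c x \<in> K})"
      by (intro openin_Union) auto
    then show "openin T {x \<in> topspace T. ?c x \<in> \<Union>\<K>}"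
      by (rule back_subst[where P = "openin T"]) auto
  qed auto
  then show ?thesis
    by (simp add: quotient_space_def topology_inverse')
qed

lemma topspace_quotient_space: "topspace (quotient_space T r) = quotient_class T r ` topspace T"
  unfolding topspace_def[of "quotient_space T r"] openin_quotient_space
  by (auto intro!: exI[of _ "quotient_class T r ` topspace T"]
      intro: back_subst[where P = "openin T", OF openin_topspace])

lemma quotient_map_quotient_class: "quotient_map T (quotient_space T r) (quotient_class T r)"
  by (auto simp: quotient_map_def topspace_quotient_space openin_quotient_space)

abbreviation unit_square :: "(real \<times> real) topology" where
  "unit_square \<equiv> top_of_set ({0..1} \<times> {0..1})"

definition cylinder :: "(real \<times> real) set topology" where
  "cylinder = quotient_space unit_square (\<lambda>p q. \<exists>y\<in>{0..1}. p = (0, y) \<and> q = (1, y))"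

definition moebius_strip :: "(real \<times> real) set topology" where
  "moebius_strip = quotient_space unit_square (\<lambda>p q. \<exists>y\<in>{0..1}. p = (0, y) \<and> q = (1, 1 - y))"

end

theory Submission
  imports Defs
begin

text \<open>
  \<^emph>\<open>Natural isomorphism.\<close>  Choose disjoint intervals (windows) in the base circle, with centres
  \<open>c\<^sub>k = 2\<^sup>-\<^sup>k\<^sup>-\<^sup>1\<close>.  Let \<open>f\<^sub>k(x, y)\<close> be obtained by squeezing the fibre over \<open>x\<close> towards its midpoint,
  completely at \<open>x = c\<^sub>k\<close> and not at all outside window \<open>k\<close>, and by flipping the fibre if \<open>x > c\<^sub>k\<close>.
  Thanks to the squeezing \<open>f\<^sub>k\<close> is continuous, and because of the flip it respects the identifications
  both as a map from the cylinder to the strip and as a map back.  The square \<open>r\<^sub>k = f\<^sub>k f\<^sub>k\<close> just pinches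
  at window \<open>k\<close>; it is idempotent and commutes with every \<open>f\<^sub>j\<close>.  Writing \<open>f\<^sub>k\<close> and \<open>r\<^sub>k\<close> also for the
  induced maps on tensor powers, put \<open>P\<^sub>k = (1 - r\<^sub>0) \<dots> (1 - r\<^sub>k\<^sub>-\<^sub>1)\<close>.  The maps \<open>r\<^sub>k P\<^sub>k\<close> are orthogonal
  idempotents, and \<open>P\<^sub>k = 0\<close> on the \<open>n\<close>-th tensor power if \<open>k > n\<close>, as \<open>n\<close> points miss one of \<open>k\<close>
  disjoint windows.  Therefore \<open>r\<^sub>0 P\<^sub>0 + \<dots> + r\<^sub>n P\<^sub>n = 1\<close>, and \<open>f\<^sub>0 P\<^sub>0 + \<dots> + f\<^sub>n P\<^sub>n\<close> is an isomorphism
  whose inverse has the same form.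

  \<^emph>\<open>Non-isomorphism.\<close>  An isomorphism of the algebras sends a planar embedding of the cylinder to an
  injective continuous complex function on the strip, which contradicts the Jordan curve theorem.
\<close>

section \<open>Linear maps between free vector spaces\<close>

interpretation pmp: vector_space_pair pm_scale pm_scale
  by unfold_locales

abbreviation pm_linear :: "(('k \<Rightarrow>\<^sub>0 complex) \<Rightarrow> ('l \<Rightarrow>\<^sub>0 complex)) \<Rightarrow> bool" where
  "pm_linear \<equiv> Vector_Spaces.linear pm_scale pm_scale"

lemma pm_linearI:
  assumes "\<And>p q. f (p + q) = f p + f q" "\<And>c p. f (pm_scale c p) = pm_scale c (f p)"
  shows "pm_linear f"
  unfolding Vector_Spaces.linear_iff by (intro conjI allI pm.vector_space_axioms assms)

lemma pm_linear_compose: "pm_linear f \<Longrightarrow> pm_linear g \<Longrightarrow> pm_linear (\<lambda>p. g (f p))"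
  by (rule pm_linearI) (simp_all add: pmp.linear_add pmp.linear_scale)

lemma pm_scale_single [simp]:
  "pm_scale c (Poly_Mapping.single k d) = Poly_Mapping.single k (c * d)"
  by (rule poly_mapping_eqI) (simp add: lookup_single when_def)

text \<open>Additivity of \<open>pm_extend\<close> needs one index set for \<open>p\<close>,
  \<open>q\<close> and \<open>p + q\<close>, whose keys may cancel; the extra summands have
  coefficient zero.\<close>

lemma pm_extend_superset:
  assumes "finite K" "Poly_Mapping.keys p \<subseteq> K"
  shows "pm_extend g p = (\<Sum>k\<in>K. Poly_Mapping.single (g k) (Poly_Mapping.lookup p k))"
  unfolding pm_extend_def using assms
  by (intro sum.mono_neutral_left) (auto simp: in_keys_iff)

lemma pm_linear_extend: "pm_linear (pm_extend g)"
proof (rule pm_linearI)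
  fix p q :: "'a \<Rightarrow>\<^sub>0 complex"
  let ?K = "Poly_Mapping.keys p \<union> Poly_Mapping.keys q"
  have "pm_extend g (p + q) = (\<Sum>k\<in>?K. Poly_Mapping.single (g k) (Poly_Mapping.lookup (p + q) k))"
    by (intro pm_extend_superset) (simp_all add: Poly_Mapping.keys_add)
  also have "\<dots> = pm_extend g p + pm_extend g q"
    by (simp add: pm_extend_superset[of ?K] lookup_add single_add sum.distrib)
  finally show "pm_extend g (p + q) = pm_extend g p + pm_extend g q" .
next
  fix c and p :: "'a \<Rightarrow>\<^sub>0 complex"
  have "pm_extend g (pm_scale c p) =
      (\<Sum>k\<in>Poly_Mapping.keys p. Poly_Mapping.single (g k) (Poly_Mapping.lookup (pm_scale c p) k))"
    by (intro pm_extend_superset) (auto simp: in_keys_iff)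
  also have "\<dots> = pm_scale c (pm_extend g p)"
    by (simp add: pm_extend_def pm.scale_sum_right)
  finally show "pm_extend g (pm_scale c p) = pm_scale c (pm_extend g p)" .
qed

lemma pm_extend_single [simp]:
  "pm_extend g (Poly_Mapping.single k c) = Poly_Mapping.single (g k) c"
  by (subst pm_extend_superset[of "{k}"]) auto

lemma pm_expansion:
  "p = (\<Sum>k\<in>Poly_Mapping.keys p. pm_scale (Poly_Mapping.lookup p k) (Poly_Mapping.single k 1))"
proof (rule poly_mapping_eqI)
  fix k
  show "Poly_Mapping.lookup p k = Poly_Mapping.lookup
      (\<Sum>k\<in>Poly_Mapping.keys p. pm_scale (Poly_Mapping.lookup p k) (Poly_Mapping.single k 1)) k"
    by (cases "k \<in> Poly_Mapping.keys p") (auto simp: lookup_sum lookup_single when_def in_keys_iff)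
qed

lemma pm_extend_cong:
  assumes "\<And>k. k \<in> Poly_Mapping.keys p \<Longrightarrow> g k = h k"
  shows "pm_extend g p = pm_extend h p"
  using assms by (simp add: pm_extend_def)

lemma pm_extend_comp: "pm_extend h (pm_extend g p) = pm_extend (\<lambda>k. h (g k)) p"
  by (simp add: pm_extend_def[of g] pm_extend_def[of "\<lambda>k. h (g k)"] pmp.linear_sum[OF pm_linear_extend])

lemma pm_extend_id: "pm_extend (\<lambda>k. k) p = p"
  using pm_expansion[of p] by (simp add: pm_extend_def)


section \<open>Tensor powers\<close>

abbreviation pure_tensor :: "(nat \<Rightarrow> 'a) \<Rightarrow> (nat \<Rightarrow> 'a) \<Rightarrow>\<^sub>0 complex" where
  "pure_tensor a \<equiv> Poly_Mapping.single a 1"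

definition rel_span :: "(complex, 'a) module \<Rightarrow> nat \<Rightarrow> ((nat \<Rightarrow> 'a) \<Rightarrow>\<^sub>0 complex) set" where
  "rel_span A n = pm_span (multilinearity_relations A n)"

lemma rel_span_zero: "0 \<in> rel_span A n"
  and rel_span_add: "p \<in> rel_span A n \<Longrightarrow> q \<in> rel_span A n \<Longrightarrow> p + q \<in> rel_span A n"
  and rel_span_diff: "p \<in> rel_span A n \<Longrightarrow> q \<in> rel_span A n \<Longrightarrow> p - q \<in> rel_span A n"
  and rel_span_scale: "p \<in> rel_span A n \<Longrightarrow> pm_scale c p \<in> rel_span A n"
  and rel_span_sum: "(\<And>i. i \<in> I \<Longrightarrow> f i \<in> rel_span A n) \<Longrightarrow> (\<Sum>i\<in>I. f i) \<in> rel_span A n"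
  unfolding rel_span_def
  by (auto intro: pm.span_zero pm.span_add pm.span_diff pm.span_scale pm.span_sum)

lemma subspace_rel_span: "pm.subspace (rel_span A n)"
  unfolding rel_span_def by (rule pm.subspace_span)

lemma rel_span_sum_relation:
  assumes "a \<in> {1..n} \<rightarrow>\<^sub>E carrier A" "i \<in> {1..n}" "x \<in> carrier A" "y \<in> carrier A"
  shows "pure_tensor (a(i := x \<oplus>\<^bsub>A\<^esub> y)) - (pure_tensor (a(i := x)) + pure_tensor (a(i := y)))
    \<in> rel_span A n"
  unfolding rel_span_def multilinearity_relations_def
  by (rule pm.span_base) (use assms in blast)

lemma rel_span_smult_relation:
  assumes "a \<in> {1..n} \<rightarrow>\<^sub>E carrier A" "i \<in> {1..n}" "x \<in> carrier A"
  shows "pure_tensor (a(i := c \<odot>\<^bsub>A\<^esub> x)) - pm_scale c (pure_tensor (a(i := x))) \<in> rel_span A n"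
  unfolding rel_span_def multilinearity_relations_def
  by (rule pm.span_base) (use assms in blast)

text \<open>The preimage of the subspace \<open>rel_span B m\<close> under \<open>f\<close> is again
  a subspace, so it contains the whole span as soon as it contains the generators.\<close>

lemma rel_span_image:
  assumes f: "pm_linear f"
    and sum: "\<And>a i x y. a \<in> {1..n} \<rightarrow>\<^sub>E carrier A \<Longrightarrow> i \<in> {1..n} \<Longrightarrow> x \<in> carrier A \<Longrightarrow>
      y \<in> carrier A \<Longrightarrow> f (pure_tensor (a(i := x \<oplus>\<^bsub>A\<^esub> y)))
        - (f (pure_tensor (a(i := x))) + f (pure_tensor (a(i := y)))) \<in> rel_span B m"
    and smult: "\<And>a i x c. a \<in> {1..n} \<rightarrow>\<^sub>E carrier A \<Longrightarrow> i \<in> {1..n} \<Longrightarrow> x \<in> carrier A \<Longrightarrow>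
      f (pure_tensor (a(i := c \<odot>\<^bsub>A\<^esub> x))) - pm_scale c (f (pure_tensor (a(i := x)))) \<in> rel_span B m"
    and p: "p \<in> rel_span A n"
  shows "f p \<in> rel_span B m"
proof -
  have "multilinearity_relations A n \<subseteq> f -` rel_span B m"
    unfolding multilinearity_relations_def using f sum smult
    by (auto simp: pmp.linear_diff pmp.linear_add simp flip: pmp.linear_scale)
  then have "rel_span A n \<subseteq> f -` rel_span B m"
    unfolding rel_span_def[of A]
    by (rule pm.span_minimal) (rule pmp.linear_subspace_vimage[OF f subspace_rel_span])
  then show ?thesis using p by auto
qed

lemma free_vectors_zero: "0 \<in> free_vectors A n"
  by (simp add: free_vectors_def)

lemma free_vectors_add: "p \<in> free_vectors A n \<Longrightarrow> q \<in> free_vectors A n \<Longrightarrow> p + q \<in> free_vectors A n"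
  unfolding free_vectors_def using Poly_Mapping.keys_add[of p q] by auto

lemma free_vectors_scale: "p \<in> free_vectors A n \<Longrightarrow> pm_scale c p \<in> free_vectors A n"
  unfolding free_vectors_def by (auto simp: in_keys_iff subset_iff)

lemma free_vectors_diff: "p \<in> free_vectors A n \<Longrightarrow> q \<in> free_vectors A n \<Longrightarrow> p - q \<in> free_vectors A n"
  unfolding free_vectors_def using Poly_Mapping.keys_diff[of p q] by auto

lemma free_vectors_sum: "(\<And>i. i \<in> I \<Longrightarrow> f i \<in> free_vectors A n) \<Longrightarrow> (\<Sum>i\<in>I. f i) \<in> free_vectors A n"
  by (induction I rule: infinite_finite_induct) (auto intro: free_vectors_add free_vectors_zero)

lemma free_vectors_single:
  "a \<in> {1..n} \<rightarrow>\<^sub>E carrier A \<Longrightarrow> Poly_Mapping.single a c \<in> free_vectors A n"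
  by (auto simp: free_vectors_def)

lemma free_vectors_extend:
  assumes "\<And>a. a \<in> {1..n} \<rightarrow>\<^sub>E carrier A \<Longrightarrow> g a \<in> {1..m} \<rightarrow>\<^sub>E carrier B" "p \<in> free_vectors A n"
  shows "pm_extend g p \<in> free_vectors B m"
  unfolding pm_extend_def using assms
  by (intro free_vectors_sum free_vectors_single) (auto simp: free_vectors_def)

lemma rel_span_of_pure_tensors:
  assumes f: "pm_linear f"
    and "\<And>a. a \<in> {1..n} \<rightarrow>\<^sub>E carrier A \<Longrightarrow> f (pure_tensor a) \<in> rel_span B m"
    and p: "p \<in> free_vectors A n"
  shows "f p \<in> rel_span B m"
proof -
  have "f p = (\<Sum>k\<in>Poly_Mapping.keys p. pm_scale (Poly_Mapping.lookup p k) (f (pure_tensor k)))"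
    by (subst (1) pm_expansion[of p]) (simp only: pmp.linear_sum[OF f] pmp.linear_scale[OF f])
  also have "\<dots> \<in> rel_span B m"
    using assms by (intro rel_span_sum rel_span_scale) (auto simp: free_vectors_def)
  finally show ?thesis .
qed

lemma tensor_class_alt: "tensor_class A n p = {q. q - p \<in> rel_span A n}"
  by (simp add: tensor_class_def rel_span_def)

lemma tensor_class_mem_iff: "q \<in> tensor_class A n p \<longleftrightarrow> q - p \<in> rel_span A n"
  by (simp add: tensor_class_alt)

lemma tensor_class_self: "p \<in> tensor_class A n p"
  by (simp add: tensor_class_alt rel_span_zero)

lemma tensor_class_eq_iff: "tensor_class A n p = tensor_class A n q \<longleftrightarrow> p - q \<in> rel_span A n"
proof
  assume "tensor_class A n p = tensor_class A n q"
  then show "p - q \<in> rel_span A n"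
    using tensor_class_self[of p A n] by (simp add: tensor_class_alt)
next
  assume pq: "p - q \<in> rel_span A n"
  show "tensor_class A n p = tensor_class A n q"
    unfolding tensor_class_alt
  proof (intro Collect_cong iffI)
    fix r
    show "r - q \<in> rel_span A n" if "r - p \<in> rel_span A n"
      using rel_span_add[OF that pq] by simp
    show "r - p \<in> rel_span A n" if "r - q \<in> rel_span A n"
      using rel_span_diff[OF that pq] by simp
  qed
qed

text \<open>All members of a coset have their images in one coset, so a union over representatives,
  as in \<open>smult\<close> and \<open>arr\<close>, collapses to a single class.\<close>

lemma tensor_class_UN:
  assumes "pm_linear f" "\<And>q. q \<in> rel_span A n \<Longrightarrow> f q \<in> rel_span B m"
  shows "(\<Union>u\<in>tensor_class A n p. tensor_class B m (f u)) = tensor_class B m (f p)"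
proof -
  have "tensor_class B m (f u) = tensor_class B m (f p)" if "u \<in> tensor_class A n p" for u
    using that assms by (simp add: tensor_class_eq_iff tensor_class_mem_iff flip: pmp.linear_diff)
  then show ?thesis using tensor_class_self by blast
qed

lemma carrier_tensor_power: "carrier (tensor_power A n) = tensor_class A n ` free_vectors A n"
  by (simp add: tensor_power_def)

lemma zero_tensor_power: "\<zero>\<^bsub>tensor_power A n\<^esub> = tensor_class A n 0"
  by (simp add: tensor_power_def)

lemma add_tensor_power:
  "tensor_class A n p \<oplus>\<^bsub>tensor_power A n\<^esub> tensor_class A n q = tensor_class A n (p + q)"
proof -
  have *: "tensor_class A n (u + v) = tensor_class A n (p + q)"
    if "u \<in> tensor_class A n p" "v \<in> tensor_class A n q" for u v
    using rel_span_add[of "u - p" A n "v - q"] that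
    by (simp add: tensor_class_eq_iff tensor_class_mem_iff algebra_simps)
  have "(\<Union>u\<in>tensor_class A n p. \<Union>v\<in>tensor_class A n q. tensor_class A n (u + v)) =
      (\<Union>u\<in>tensor_class A n p. \<Union>v\<in>tensor_class A n q. tensor_class A n (p + q))"
    by (intro SUP_cong refl *)
  also have "\<dots> = tensor_class A n (p + q)"
    using tensor_class_self[of p A n] tensor_class_self[of q A n] by blast
  finally show ?thesis by (simp add: tensor_power_def)
qed

lemma smult_tensor_power:
  "c \<odot>\<^bsub>tensor_power A n\<^esub> tensor_class A n p = tensor_class A n (pm_scale c p)"
  unfolding tensor_power_def
  by (simp, rule tensor_class_UN)
     (auto intro!: pm_linearI rel_span_scale simp: pm.scale_right_distrib mult.commute)

lemmas tensor_power_simps =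
  carrier_tensor_power zero_tensor_power add_tensor_power smult_tensor_power

lemma module_tensor_power: "module complex_ring (tensor_power A n)"
proof (rule moduleI)
  show "cring complex_ring" by (rule cring_from_type_algebra)
  show "abelian_group (tensor_power A n)"
  proof (rule abelian_groupI)
    fix U assume "U \<in> carrier (tensor_power A n)"
    then obtain p where p: "p \<in> free_vectors A n" "U = tensor_class A n p"
      by (auto simp: tensor_power_simps)
    show "\<exists>V\<in>carrier (tensor_power A n). V \<oplus>\<^bsub>tensor_power A n\<^esub> U = \<zero>\<^bsub>tensor_power A n\<^esub>"
      using p free_vectors_scale[of p A n "-1"]
      by (intro bexI[of _ "tensor_class A n (pm_scale (-1) p)"])
         (auto simp: tensor_power_simps)
  qed (auto simp: tensor_power_simps free_vectors_zero free_vectors_add algebra_simps)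
qed (auto simp: tensor_power_simps ring_of_type_algebra_def free_vectors_scale
    pm.scale_left_distrib pm.scale_right_distrib)

section \<open>Maps of tensor powers induced by maps of free vectors\<close>

definition induced_map :: "(complex, 'a) module \<Rightarrow> nat \<Rightarrow>
    (((nat \<Rightarrow> 'b) \<Rightarrow>\<^sub>0 complex) \<Rightarrow> ((nat \<Rightarrow> 'a) \<Rightarrow>\<^sub>0 complex)) \<Rightarrow>
    ((nat \<Rightarrow> 'b) \<Rightarrow>\<^sub>0 complex) set \<Rightarrow> ((nat \<Rightarrow> 'a) \<Rightarrow>\<^sub>0 complex) set" where
  "induced_map A m f U = (\<Union>u\<in>U. tensor_class A m (f u))"

text \<open>Preserving free vectors makes the induced map land in the carrier, and preserving
  relations makes it independent of representatives.\<close>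

definition tensor_compatible :: "(complex, 'a) module \<Rightarrow> nat \<Rightarrow> (complex, 'b) module \<Rightarrow> nat \<Rightarrow>
    (((nat \<Rightarrow> 'a) \<Rightarrow>\<^sub>0 complex) \<Rightarrow> ((nat \<Rightarrow> 'b) \<Rightarrow>\<^sub>0 complex)) \<Rightarrow> bool" where
  "tensor_compatible A n B m f \<longleftrightarrow> pm_linear f \<and> (\<forall>p\<in>free_vectors A n. f p \<in> free_vectors B m) \<and>
     (\<forall>p\<in>rel_span A n. f p \<in> rel_span B m)"

lemma induced_map_class:
  "tensor_compatible A n B m f \<Longrightarrow>
    induced_map B m f (tensor_class A n p) = tensor_class B m (f p)"
  unfolding induced_map_def tensor_compatible_def by (intro tensor_class_UN) auto

lemma induced_map_linear:
  assumes "tensor_compatible A n B m f"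
  shows "induced_map B m f \<in> linear_maps (tensor_power A n) (tensor_power B m)"
  using assms unfolding linear_maps_def
  by (auto simp: tensor_power_simps induced_map_class)
     (auto simp: tensor_compatible_def pmp.linear_add pmp.linear_scale)

text \<open>By \<open>lin\<close>, varying one entry of \<open>a\<close> varies just one entry of
  \<open>g a\<close>, through a linear map; so a multilinearity relation at \<open>i\<close> goes to
  one at \<open>j\<close>.\<close>

lemma tensor_compatible_extend:
  assumes closed: "\<And>a. a \<in> {1..n} \<rightarrow>\<^sub>E carrier A \<Longrightarrow> g a \<in> {1..m} \<rightarrow>\<^sub>E carrier B"
    and lin: "\<And>a i. a \<in> {1..n} \<rightarrow>\<^sub>E carrier A \<Longrightarrow> i \<in> {1..n} \<Longrightarrow>
      \<exists>j\<in>{1..m}. \<exists>b\<in>{1..m} \<rightarrow>\<^sub>E carrier B. \<exists>l\<in>linear_maps A B. \<forall>x\<in>carrier A. g (a(i := x)) = b(j := l x)"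
    and A: "module complex_ring A"
  shows "tensor_compatible A n B m (pm_extend g)"
  unfolding tensor_compatible_def
proof (intro conjI pm_linear_extend ballI)
  interpret A: Module.module complex_ring A by fact
  fix p assume "p \<in> rel_span A n"
  then show "pm_extend g p \<in> rel_span B m"
  proof (rule rel_span_image[OF pm_linear_extend, rotated 2])
    fix a i x y
    assume a: "a \<in> {1..n} \<rightarrow>\<^sub>E carrier A" "i \<in> {1..n}" and x: "x \<in> carrier A"
    obtain j b l where j: "j \<in> {1..m}" "b \<in> {1..m} \<rightarrow>\<^sub>E carrier B" and l: "l \<in> linear_maps A B"
      and g: "\<And>x. x \<in> carrier A \<Longrightarrow> g (a(i := x)) = b(j := l x)"
      using lin[OF a] by blast
    show "pm_extend g (pure_tensor (a(i := x \<oplus>\<^bsub>A\<^esub> y)))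
        - (pm_extend g (pure_tensor (a(i := x))) + pm_extend g (pure_tensor (a(i := y)))) \<in> rel_span B m"
      if y: "y \<in> carrier A"
      using rel_span_sum_relation[OF j(2,1), of "l x" "l y"] l x y
      by (auto simp: g linear_maps_def)
    show "pm_extend g (pure_tensor (a(i := c \<odot>\<^bsub>A\<^esub> x)))
        - pm_scale c (pm_extend g (pure_tensor (a(i := x)))) \<in> rel_span B m" for c
      using rel_span_smult_relation[OF j(2,1), of "l x" c] l x A.smult_closed[of c x]
      by (auto simp: g linear_maps_def ring_of_type_algebra_def)
  qed
next
  show "pm_extend g p \<in> free_vectors B m" if "p \<in> free_vectors A n" for p
    using closed that by (rule free_vectors_extend)
qed


section \<open>The Loday functor\<close>

lemma arr_loday: "arr (loday A) n m \<sigma> = induced_map A m (pm_extend (fibre_prods A n m \<sigma>))"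
  by (simp add: loday_def induced_map_def fun_eq_iff)

lemma obj_loday: "obj (loday A) = tensor_power A"
  by (simp add: loday_def)

lemma surjections_fibre:
  assumes "\<sigma> \<in> surjections n m" "j \<in> {1..m}"
  shows "{i \<in> {1..n}. \<sigma> i = j} \<noteq> {}"
proof -
  have "j \<in> \<sigma> ` {1..n}" using assms by (auto simp: surjections_def)
  then show ?thesis by auto
qed

lemma surjections_mem: "\<sigma> \<in> surjections n m \<Longrightarrow> i \<in> {1..n} \<Longrightarrow> \<sigma> i \<in> {1..m}"
  by (auto simp: surjections_def PiE_iff)

lemma surjections_compose:
  assumes "\<sigma> \<in> surjections n m" "\<tau> \<in> surjections m l"
  shows "compose {1..n} \<tau> \<sigma> \<in> surjections n l"
proof -
  have "compose {1..n} \<tau> \<sigma> ` {1..n} = \<tau> ` \<sigma> ` {1..n}"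
    unfolding image_image by (rule image_cong) (simp_all add: compose_def)
  then show ?thesis
    using assms by (auto simp: surjections_def PiE_iff compose_def)
qed

section \<open>Functoriality of multiplication along surjections\<close>

context
  fixes A :: "(complex, 'a) module"
  assumes A: "algebra complex_ring A"
begin

interpretation A: algebra complex_ring A by (rule A)

lemma fibre_prods_finprod:
  assumes "\<sigma> \<in> surjections n m" "a \<in> {1..n} \<rightarrow>\<^sub>E carrier A"
  shows "fibre_prods A n m \<sigma> a = (\<lambda>j\<in>{1..m}. finprod A a {i \<in> {1..n}. \<sigma> i = j})"
  unfolding fibre_prods_def
proof (rule restrict_ext)
  fix j assume "j \<in> {1..m}"
  then show "fibre_prod A a {i \<in> {1..n}. \<sigma> i = j} = finprod A a {i \<in> {1..n}. \<sigma> i = j}"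
    using assms surjections_fibre[OF assms(1)]
    by (intro fibre_prod_eq_finprod) (auto intro: A.comm_monoid_axioms)
qed

lemma fibre_prods_closed:
  assumes "\<sigma> \<in> surjections n m" "a \<in> {1..n} \<rightarrow>\<^sub>E carrier A"
  shows "fibre_prods A n m \<sigma> a \<in> {1..m} \<rightarrow>\<^sub>E carrier A"
  using assms by (auto simp: fibre_prods_finprod intro!: A.finprod_closed)

lemma tensor_compatible_fibre_prods:
  assumes \<sigma>: "\<sigma> \<in> surjections n m"
  shows "tensor_compatible A n A m (pm_extend (fibre_prods A n m \<sigma>))"
proof (rule tensor_compatible_extend)
  fix a i assume a: "a \<in> {1..n} \<rightarrow>\<^sub>E carrier A" and i: "i \<in> {1..n}"
  \<comment> \<open>Only the product over the fibre through \<open>i\<close> depends on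
    \<open>a i\<close>; there \<open>a i\<close> is multiplied by the product \<open>?c\<close> of
    the other factors, which is the unit for a one-point fibre.\<close>
  let ?S = "{i' \<in> {1..n}. \<sigma> i' = \<sigma> i} - {i}"
  let ?c = "finprod A a ?S"
  have c: "?c \<in> carrier A" using a by (intro A.finprod_closed) auto
  have "fibre_prods A n m \<sigma> (a(i := x)) = (fibre_prods A n m \<sigma> a)(\<sigma> i := x \<otimes>\<^bsub>A\<^esub> ?c)"
    if x: "x \<in> carrier A" for x
  proof (rule ext)
    fix j
    have ax: "a(i := x) \<in> {1..n} \<rightarrow>\<^sub>E carrier A" using a i x by (auto simp: PiE_iff extensional_def)
    show "fibre_prods A n m \<sigma> (a(i := x)) j = ((fibre_prods A n m \<sigma> a)(\<sigma> i := x \<otimes>\<^bsub>A\<^esub> ?c)) j"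
    proof (cases "j = \<sigma> i")
      case True
      have eq: "{i' \<in> {1..n}. \<sigma> i' = \<sigma> i} = insert i ?S" using i by auto
      have "finprod A (a(i := x)) {i' \<in> {1..n}. \<sigma> i' = \<sigma> i} = x \<otimes>\<^bsub>A\<^esub> finprod A (a(i := x)) ?S"
        by (subst eq, subst A.finprod_insert) (use ax x a in \<open>auto simp: PiE_iff\<close>)
      also have "finprod A (a(i := x)) ?S = ?c"
        using a by (intro A.finprod_cong') auto
      finally show ?thesis
        using True surjections_mem[OF \<sigma> i] by (simp only: fibre_prods_finprod[OF \<sigma> ax] restrict_apply fun_upd_same if_True)
    next
      case False
      have "finprod A (a(i := x)) {i' \<in> {1..n}. \<sigma> i' = j} = finprod A a {i' \<in> {1..n}. \<sigma> i' = j}"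
        using a False by (intro A.finprod_cong') auto
      then show ?thesis
        using False by (simp add: fibre_prods_finprod[OF \<sigma> ax] fibre_prods_finprod[OF \<sigma> a] restrict_def)
    qed
  qed
  moreover have "(\<lambda>x. x \<otimes>\<^bsub>A\<^esub> ?c) \<in> linear_maps A A"
    using c by (auto simp: linear_maps_def A.l_distr A.smult_assoc2 ring_of_type_algebra_def)
  ultimately show "\<exists>j\<in>{1..m}. \<exists>b\<in>{1..m} \<rightarrow>\<^sub>E carrier A. \<exists>l\<in>linear_maps A A.
      \<forall>x\<in>carrier A. fibre_prods A n m \<sigma> (a(i := x)) = b(j := l x)"
    using surjections_mem[OF \<sigma> i] fibre_prods_closed[OF \<sigma> a]
    by (intro bexI[of _ "\<sigma> i"] bexI[of _ "fibre_prods A n m \<sigma> a"]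
        bexI[of _ "\<lambda>x. x \<otimes>\<^bsub>A\<^esub> ?c"] ballI)
qed (use fibre_prods_closed[OF \<sigma>] A.module_axioms in auto)

lemma fibre_prods_id:
  assumes "a \<in> {1..n} \<rightarrow>\<^sub>E carrier A"
  shows "fibre_prods A n n (\<lambda>i\<in>{1..n}. i) a = a"
proof
  fix j
  have "{i \<in> {1..n}. (\<lambda>i\<in>{1..n}. i) i = j} = {j}" if "j \<in> {1..n}"
    using that by auto
  then show "fibre_prods A n n (\<lambda>i\<in>{1..n}. i) a j = a j"
    using assms by (auto simp: fibre_prods_def fibre_prod_def PiE_iff extensional_def)
qed

text \<open>A fibre of the composite is the disjoint union of the fibres of \<sigma> over a fibre of
  \<tau>, so the product can be taken in two stages.\<close>

lemma fibre_prods_compose: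
  assumes \<sigma>: "\<sigma> \<in> surjections n m" and \<tau>: "\<tau> \<in> surjections m l"
    and a: "a \<in> {1..n} \<rightarrow>\<^sub>E carrier A"
  shows "fibre_prods A n l (compose {1..n} \<tau> \<sigma>) a = fibre_prods A m l \<tau> (fibre_prods A n m \<sigma> a)"
proof -
  have \<tau>\<sigma>: "compose {1..n} \<tau> \<sigma> \<in> surjections n l"
    using \<sigma> \<tau> by (rule surjections_compose)
  have "finprod A a {i \<in> {1..n}. compose {1..n} \<tau> \<sigma> i = k} =
      finprod A (fibre_prods A n m \<sigma> a) {j \<in> {1..m}. \<tau> j = k}" for k
  proof -
    have eq: "{i \<in> {1..n}. compose {1..n} \<tau> \<sigma> i = k} =
        (\<Union>j\<in>{j \<in> {1..m}. \<tau> j = k}. {i \<in> {1..n}. \<sigma> i = j})"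
      using surjections_mem[OF \<sigma>] by (auto simp: compose_def)
    have "finprod A a {i \<in> {1..n}. compose {1..n} \<tau> \<sigma> i = k} =
        finprod A (\<lambda>j. finprod A a {i \<in> {1..n}. \<sigma> i = j}) {j \<in> {1..m}. \<tau> j = k}"
      unfolding eq using a by (intro A.finprod_UN_disjoint) (auto simp: pairwise_def disjnt_def PiE_iff)
    also have "\<dots> = finprod A (fibre_prods A n m \<sigma> a) {j \<in> {1..m}. \<tau> j = k}"
      using a by (intro A.finprod_cong')
        (auto simp: fibre_prods_finprod[OF \<sigma> a] PiE_iff intro!: A.finprod_closed)
    finally show ?thesis .
  qed
  then show ?thesis
    unfolding fibre_prods_finprod[OF \<tau>\<sigma> a] fibre_prods_finprod[OF \<tau> fibre_prods_closed[OF \<sigma> a]]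
    by simp
qed

lemma is_omega_functor_loday: "is_omega_functor (loday A)"
  unfolding is_omega_functor_def
proof (intro conjI allI impI ballI)
  fix n m \<sigma> assume "\<sigma> \<in> surjections n m"
  then show "arr (loday A) n m \<sigma> \<in> linear_maps (obj (loday A) n) (obj (loday A) m)"
    by (simp add: arr_loday obj_loday induced_map_linear tensor_compatible_fibre_prods)
next
  fix n v assume "v \<in> carrier (obj (loday A) n)"
  then obtain p where p: "p \<in> free_vectors A n" "v = tensor_class A n p"
    by (auto simp: obj_loday carrier_tensor_power)
  have "(\<lambda>i\<in>{1..n}. i) \<in> surjections n n" by (auto simp: surjections_def)
  moreover have "pm_extend (fibre_prods A n n (\<lambda>i\<in>{1..n}. i)) p = p"
    by (subst pm_extend_cong[of p _ "\<lambda>a. a"])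
       (use p in \<open>auto simp: free_vectors_def pm_extend_id simp del: One_nat_def intro!: fibre_prods_id\<close>)
  ultimately show "arr (loday A) n n (\<lambda>i\<in>{1..n}. i) v = v"
    using p by (simp add: arr_loday induced_map_class tensor_compatible_fibre_prods)
next
  fix n m l \<sigma> \<tau> v
  assume \<sigma>: "\<sigma> \<in> surjections n m" and \<tau>: "\<tau> \<in> surjections m l" and "v \<in> carrier (obj (loday A) n)"
  then obtain p where p: "p \<in> free_vectors A n" "v = tensor_class A n p"
    by (auto simp: obj_loday carrier_tensor_power)
  have \<tau>\<sigma>: "compose {1..n} \<tau> \<sigma> \<in> surjections n l"
    using \<sigma> \<tau> by (rule surjections_compose)
  have "pm_extend (fibre_prods A n l (compose {1..n} \<tau> \<sigma>)) p =
      pm_extend (fibre_prods A m l \<tau>) (pm_extend (fibre_prods A n m \<sigma>) p)"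
    unfolding pm_extend_comp using p fibre_prods_compose[OF \<sigma> \<tau>]
    by (intro pm_extend_cong) (auto simp: free_vectors_def)
  then show "arr (loday A) n l (compose {1..n} \<tau> \<sigma>) v = arr (loday A) m l \<tau> (arr (loday A) n m \<sigma> v)"
    using p \<sigma> \<tau> \<tau>\<sigma> by (simp add: arr_loday induced_map_class[OF tensor_compatible_fibre_prods])
qed (simp add: obj_loday module_tensor_power)

end


section \<open>Tensor powers of linear maps\<close>

lemma linear_maps_closed: "f \<in> linear_maps V W \<Longrightarrow> v \<in> carrier V \<Longrightarrow> f v \<in> carrier W"
  by (auto simp: linear_maps_def)

lemma linear_maps_compose:
  "f \<in> linear_maps U V \<Longrightarrow> g \<in> linear_maps V W \<Longrightarrow> (\<lambda>x. g (f x)) \<in> linear_maps U W"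
  by (auto simp: linear_maps_def Pi_iff)

definition algebra_homs :: "(complex, 'a) module \<Rightarrow> (complex, 'b) module \<Rightarrow> ('a \<Rightarrow> 'b) set" where
  "algebra_homs A B = {f \<in> linear_maps A B.
     \<forall>x\<in>carrier A. \<forall>y\<in>carrier A. f (x \<otimes>\<^bsub>A\<^esub> y) = f x \<otimes>\<^bsub>B\<^esub> f y}"

lemma algebra_homs_compose:
  "f \<in> algebra_homs A B \<Longrightarrow> g \<in> algebra_homs B C \<Longrightarrow> (\<lambda>x. g (f x)) \<in> algebra_homs A C"
  by (auto simp: algebra_homs_def linear_maps_compose linear_maps_closed)

definition tensor_map :: "nat \<Rightarrow> ('a \<Rightarrow> 'b) \<Rightarrow> ((nat \<Rightarrow> 'a) \<Rightarrow>\<^sub>0 complex) \<Rightarrow> (nat \<Rightarrow> 'b) \<Rightarrow>\<^sub>0 complex" where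
  "tensor_map n f = pm_extend (\<lambda>a. \<lambda>i\<in>{1..n}. f (a i))"

lemma pm_linear_tensor_map: "pm_linear (tensor_map n f)"
  unfolding tensor_map_def by (rule pm_linear_extend)

lemma tensor_map_comp: "tensor_map n g (tensor_map n f p) = tensor_map n (\<lambda>x. g (f x)) p"
  unfolding tensor_map_def pm_extend_comp by (simp cong: restrict_cong)

lemma tensor_map_cong:
  assumes "p \<in> free_vectors A n" "\<And>x. x \<in> carrier A \<Longrightarrow> f x = g x"
  shows "tensor_map n f p = tensor_map n g p"
  unfolding tensor_map_def using assms
  by (intro pm_extend_cong restrict_ext) (auto simp: free_vectors_def PiE_iff subset_iff)

lemma tensor_map_fixed:
  assumes "a \<in> {1..n} \<rightarrow>\<^sub>E carrier A" "\<And>i. i \<in> {1..n} \<Longrightarrow> f (a i) = a i"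
  shows "tensor_map n f (pure_tensor a) = pure_tensor a"
proof -
  have "(\<lambda>i\<in>{1..n}. f (a i)) = a"
    using assms by (intro ext) (auto simp: PiE_iff extensional_def)
  then show ?thesis by (simp add: tensor_map_def)
qed

lemma tensor_compatible_tensor_map:
  assumes f: "f \<in> linear_maps A B" and A: "module complex_ring A"
  shows "tensor_compatible A n B n (tensor_map n f)"
  unfolding tensor_map_def
proof (rule tensor_compatible_extend)
  show closed: "(\<lambda>i\<in>{1..n}. f (a i)) \<in> {1..n} \<rightarrow>\<^sub>E carrier B" if "a \<in> {1..n} \<rightarrow>\<^sub>E carrier A" for a
    using that linear_maps_closed[OF f] by (auto simp: PiE_iff)
  show "\<exists>j\<in>{1..n}. \<exists>b\<in>{1..n} \<rightarrow>\<^sub>E carrier B. \<exists>l\<in>linear_maps A B.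
      \<forall>x\<in>carrier A. (\<lambda>i'\<in>{1..n}. f ((a(i := x)) i')) = b(j := l x)"
    if "a \<in> {1..n} \<rightarrow>\<^sub>E carrier A" "i \<in> {1..n}" for a i
    by (rule bexI[OF _ that(2)], rule bexI[OF _ closed[OF that(1)]], rule bexI[OF _ f])
       (use that in \<open>auto simp: fun_eq_iff\<close>)
qed fact

lemma tensor_compatible_linear: "tensor_compatible A n B m f \<Longrightarrow> pm_linear f"
  and tensor_compatible_free: "tensor_compatible A n B m f \<Longrightarrow> p \<in> free_vectors A n \<Longrightarrow> f p \<in> free_vectors B m"
  and tensor_compatible_rel: "tensor_compatible A n B m f \<Longrightarrow> p \<in> rel_span A n \<Longrightarrow> f p \<in> rel_span B m"
  by (auto simp: tensor_compatible_def)

lemma tensor_compatible_id: "tensor_compatible A n A n (\<lambda>p. p)"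
  by (simp add: tensor_compatible_def pm_linearI)

lemma tensor_compatible_compose:
  "tensor_compatible A n B m f \<Longrightarrow> tensor_compatible B m C l g \<Longrightarrow>
    tensor_compatible A n C l (\<lambda>p. g (f p))"
  by (auto simp: tensor_compatible_def pm_linear_compose)

lemma tensor_compatible_diff:
  "tensor_compatible A n B m f \<Longrightarrow> tensor_compatible A n B m g \<Longrightarrow>
    tensor_compatible A n B m (\<lambda>p. f p - g p)"
  by (auto simp: tensor_compatible_def pmp.linear_compose_sub free_vectors_diff rel_span_diff)

lemma tensor_compatible_sum:
  assumes "\<And>k. k \<in> I \<Longrightarrow> tensor_compatible A n B m (f k)"
  shows "tensor_compatible A n B m (\<lambda>p. \<Sum>k\<in>I. f k p)"
  unfolding tensor_compatible_def
proof (intro conjI ballI)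
  show "pm_linear (\<lambda>p. \<Sum>k\<in>I. f k p)"
    by (intro pmp.linear_compose_sum ballI tensor_compatible_linear[OF assms])
qed (auto intro!: free_vectors_sum rel_span_sum intro: tensor_compatible_free[OF assms] tensor_compatible_rel[OF assms])

text \<open>Multiplicativity moves \<open>f\<close> through the \<open>foldl\<close> one factor at a
  time. The family \<open>b\<close> is prescribed on \<open>S\<close> only, so that it can be the
  restricted family formed by \<open>tensor_map\<close>.\<close>

lemma hom_fibre_prod:
  assumes A: "Group.monoid A" and f: "f \<in> algebra_homs A B" and S: "finite S" "S \<noteq> {}"
    and a: "a \<in> S \<rightarrow> carrier A" and b: "\<And>i. i \<in> S \<Longrightarrow> b i = f (a i)"
  shows "f (fibre_prod A a S) = fibre_prod B b S"
proof -
  have *: "f (foldl (mult A) x (map a xs)) = foldl (mult B) (f x) (map b xs)"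
    if "x \<in> carrier A" "set xs \<subseteq> S" for x xs
    using that
  proof (induction xs arbitrary: x)
    case (Cons y ys)
    then have y: "a y \<in> carrier A" "b y = f (a y)" using a b by auto
    have "f (foldl (mult A) (x \<otimes>\<^bsub>A\<^esub> a y) (map a ys)) =
        foldl (mult B) (f (x \<otimes>\<^bsub>A\<^esub> a y)) (map b ys)"
      using Cons y by (intro Cons.IH monoid.m_closed[OF A]) auto
    then show ?case using y Cons.prems f by (simp add: algebra_homs_def)
  qed simp
  have "Min S \<in> S" using S by simp
  then have "a (Min S) \<in> carrier A" "b (Min S) = f (a (Min S))" using a b by auto
  then show ?thesis
    unfolding fibre_prod_def using S by (subst *) auto
qed

lemma tensor_map_natural:
  assumes A: "algebra complex_ring A" and f: "f \<in> algebra_homs A B"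
    and \<sigma>: "\<sigma> \<in> surjections n m" and p: "p \<in> free_vectors A n"
  shows "tensor_map m f (pm_extend (fibre_prods A n m \<sigma>) p) =
    pm_extend (fibre_prods B n m \<sigma>) (tensor_map n f p)"
  unfolding tensor_map_def pm_extend_comp
proof (rule pm_extend_cong)
  interpret A: algebra complex_ring A by fact
  fix a assume "a \<in> Poly_Mapping.keys p"
  then have a: "a \<in> {1..n} \<rightarrow>\<^sub>E carrier A" using p by (auto simp: free_vectors_def)
  have "f (fibre_prod A a {i \<in> {1..n}. \<sigma> i = j}) =
      fibre_prod B (\<lambda>i\<in>{1..n}. f (a i)) {i \<in> {1..n}. \<sigma> i = j}" if "j \<in> {1..m}" for j
    using a surjections_fibre[OF \<sigma> that]
    by (intro hom_fibre_prod[OF A.monoid_axioms f]) (auto simp: PiE_iff)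
  then show "(\<lambda>i\<in>{1..m}. f (fibre_prods A n m \<sigma> a i)) =
      fibre_prods B n m \<sigma> (\<lambda>i\<in>{1..n}. f (a i))"
    unfolding fibre_prods_def by (intro restrict_ext) simp
qed


section \<open>Pinchings\<close>

text \<open>This is \<open>P\<^sub>k\<close>, kept on free vectors rather than on cosets: its
  algebraic identities then hold exactly, and only its vanishing for \<open>k > n\<close> uses the
  multilinearity relations.\<close>

primrec unpinched :: "(nat \<Rightarrow> 'a \<Rightarrow> 'a) \<Rightarrow> nat \<Rightarrow> nat \<Rightarrow>
    ((nat \<Rightarrow> 'a) \<Rightarrow>\<^sub>0 complex) \<Rightarrow> (nat \<Rightarrow> 'a) \<Rightarrow>\<^sub>0 complex" where
  "unpinched r n 0 p = p"
| "unpinched r n (Suc k) p = unpinched r n k p - tensor_map n (r k) (unpinched r n k p)"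

lemma tensor_compatible_unpinched:
  assumes "\<And>k. r k \<in> linear_maps A A" "module complex_ring A"
  shows "tensor_compatible A n A n (unpinched r n k)"
proof (induction k)
  case 0
  have "unpinched r n 0 = (\<lambda>p. p)" by (simp add: fun_eq_iff)
  then show ?case using tensor_compatible_id by metis
next
  case (Suc k)
  have eq: "unpinched r n (Suc k) =
      (\<lambda>p. unpinched r n k p - tensor_map n (r k) (unpinched r n k p))"
    by (simp add: fun_eq_iff)
  show ?case
    unfolding eq using assms
    by (intro tensor_compatible_diff tensor_compatible_compose[OF Suc] tensor_compatible_tensor_map Suc)
qed

text \<open>A map that intertwines the pinchings intertwines each factor \<open>1 - r k\<close>.
  This moves \<alpha>, \<beta> and the pinchings themselves past \<open>P\<^sub>k\<close>.\<close>

lemma tensor_map_unpinched: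
  assumes f: "f \<in> linear_maps A B" and A: "module complex_ring A"
    and r: "\<And>k. r k \<in> linear_maps A A"
    and comm: "\<And>k x. x \<in> carrier A \<Longrightarrow> f (r k x) = s k (f x)"
    and p: "p \<in> free_vectors A n"
  shows "tensor_map n f (unpinched r n k p) = unpinched s n k (tensor_map n f p)"
proof (induction k)
  case (Suc k)
  have "unpinched r n k p \<in> free_vectors A n"
    by (rule tensor_compatible_free[OF tensor_compatible_unpinched[OF r A] p])
  then have "tensor_map n f (tensor_map n (r k) (unpinched r n k p)) =
      tensor_map n (s k) (tensor_map n f (unpinched r n k p))"
    unfolding tensor_map_comp using comm by (rule tensor_map_cong)
  then show ?case by (simp add: pmp.linear_diff[OF pm_linear_tensor_map] Suc)
qed simp

text \<open>As each \<open>r k\<close> is multiplicative, its tensor powers commute with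
  multiplication along \<sigma>, and so does each factor \<open>1 - r k\<close>.\<close>

lemma unpinched_natural:
  assumes A: "algebra complex_ring A" and r: "\<And>k. r k \<in> algebra_homs A A"
    and \<sigma>: "\<sigma> \<in> surjections n m" and p: "p \<in> free_vectors A n"
  shows "unpinched r m k (pm_extend (fibre_prods A n m \<sigma>) p) =
    pm_extend (fibre_prods A n m \<sigma>) (unpinched r n k p)"
proof (induction k)
  case (Suc k)
  interpret A: algebra complex_ring A by fact
  have "\<And>k. r k \<in> linear_maps A A" using r by (simp add: algebra_homs_def)
  then have "unpinched r n k p \<in> free_vectors A n"
    using tensor_compatible_free[OF tensor_compatible_unpinched p] A.module_axioms by blast
  then show ?case
    using Suc by (simp add: pmp.linear_diff[OF pm_linear_extend] tensor_map_natural[OF A r \<sigma>])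
qed simp

text \<open>In \<open>split\<close>, \<open>z\<close> is the difference of \<open>x\<close> and
  \<open>r j x\<close>, thought of as supported in window \<open>j\<close>; that the other pinchings
  fix it is the algebraic form of disjointness of the windows.\<close>

locale pinching_family =
  fixes A :: "(complex, 'a) module" and r :: "nat \<Rightarrow> 'a \<Rightarrow> 'a"
  assumes algebra: "algebra complex_ring A"
    and hom: "\<And>k. r k \<in> algebra_homs A A"
    and idem: "\<And>k x. x \<in> carrier A \<Longrightarrow> r k (r k x) = r k x"
    and comm: "\<And>j k x. x \<in> carrier A \<Longrightarrow> r j (r k x) = r k (r j x)"
    and split: "\<And>j x. x \<in> carrier A \<Longrightarrow>
      \<exists>z\<in>carrier A. x = z \<oplus>\<^bsub>A\<^esub> r j x \<and> (\<forall>k. k \<noteq> j \<longrightarrow> r k z = z)"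
begin

lemma module: "module complex_ring A"
  using algebra by (simp add: algebra_def)

lemma linear: "r k \<in> linear_maps A A"
  using hom by (simp add: algebra_homs_def)

lemmas compatible = tensor_compatible_unpinched[of r, OF linear module]

lemma free_unpinched: "p \<in> free_vectors A n \<Longrightarrow> unpinched r n k p \<in> free_vectors A n"
  by (rule tensor_compatible_free[OF compatible])

lemma pinch_comm:
  "p \<in> free_vectors A n \<Longrightarrow>
    tensor_map n (r j) (tensor_map n (r k) p) = tensor_map n (r k) (tensor_map n (r j) p)"
  unfolding tensor_map_comp by (rule tensor_map_cong) (auto intro: comm)

text \<open>The idempotent \<open>r l\<close> kills the factor \<open>1 - r l\<close> of
  \<open>P\<^sub>k\<close>, and the pinchings commute.\<close>

lemma pinch_unpinched:
  assumes p: "p \<in> free_vectors A n" and "l < k"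
  shows "tensor_map n (r l) (unpinched r n k p) = 0"
  using \<open>l < k\<close>
proof (induction k)
  case (Suc k)
  let ?p = "unpinched r n k p"
  have p': "?p \<in> free_vectors A n" using p by (rule free_unpinched)
  \<comment> \<open>For \<open>l = k\<close> this is idempotence; for \<open>l < k\<close> both
    sides are zero by the induction hypothesis.\<close>
  have "tensor_map n (r l) ?p = tensor_map n (r k) (tensor_map n (r l) ?p)"
  proof (cases "l = k")
    case True
    then show ?thesis
      unfolding tensor_map_comp by (intro tensor_map_cong[OF p']) (simp add: idem)
  next
    case False
    then show ?thesis using Suc by (simp add: pmp.linear_0[OF pm_linear_tensor_map])
  qed
  then show ?case
    by (simp add: pmp.linear_diff[OF pm_linear_tensor_map] pinch_comm[OF p', of l k])
qed simp

lemma unpinched_eq_self: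
  assumes "\<And>l. l < k \<Longrightarrow> tensor_map n (r l) p = 0"
  shows "unpinched r n k p = p"
  using assms by (induction k) auto

text \<open>The factors before \<open>1 - r j\<close> commute with \<open>r j\<close>, so their
  result is still fixed by it and is killed by \<open>1 - r j\<close>; the later factors preserve
  zero.\<close>

lemma unpinched_eq_0:
  assumes p: "p \<in> free_vectors A n" and fixed: "tensor_map n (r j) p = p" and "j < k"
  shows "unpinched r n k p = 0"
  using \<open>j < k\<close>
proof (induction k)
  case (Suc k)
  show ?case
  proof (cases "j = k")
    case True
    have "tensor_map n (r j) (unpinched r n k p) = unpinched r n k (tensor_map n (r j) p)"
      using linear module p by (intro tensor_map_unpinched[where A = A and B = A]) (auto intro: comm)
    then show ?thesis using True fixed by simp
  next
    case False
    then show ?thesis using Suc by (simp add: pmp.linear_0[OF pm_linear_tensor_map])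
  qed
qed simp

text \<open>
  Here \<open>C i\<close> is a set of windows meeting the support of the \<open>i\<close>-th factor.  Splitting the factors
  makes every \<open>C i\<close> at most a singleton, and then one of the \<open>k > n\<close> windows is missed altogether.
\<close>

lemma unpinched_pure_tensor:
  assumes "n < k" "a \<in> {1..n} \<rightarrow>\<^sub>E carrier A" "\<And>i. i \<in> {1..n} \<Longrightarrow> C i \<subseteq> {..<k}"
    and "\<And>i j. i \<in> {1..n} \<Longrightarrow> j < k \<Longrightarrow> j \<notin> C i \<Longrightarrow> r j (a i) = a i"
  shows "unpinched r n k (pure_tensor a) \<in> rel_span A n"
  using assms
proof (induction "\<Sum>i\<in>{1..n}. card (C i)" arbitrary: a C rule: less_induct)
  case less
  note a = less.prems(2) and C = less.prems(3) and fixed = less.prems(4)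
  have fin: "finite (C i)" if "i \<in> {1..n}" for i
    using C[OF that] by (rule finite_subset) simp
  show ?case
  proof (cases "\<forall>i\<in>{1..n}. card (C i) \<le> 1")
    case True
    have "card (\<Union>i\<in>{1..n}. C i) \<le> (\<Sum>i\<in>{1..n}. card (C i))" by (rule card_UN_le) simp
    also have "\<dots> \<le> (\<Sum>i\<in>{1..n}. 1)" using True by (intro sum_mono) auto
    also have "\<dots> < card {..<k}" using less.prems(1) by simp
    finally have "(\<Union>i\<in>{1..n}. C i) \<noteq> {..<k}" by auto
    then obtain j where "j < k" "\<And>i. i \<in> {1..n} \<Longrightarrow> j \<notin> C i" using C by blast
    then have "unpinched r n k (pure_tensor a) = 0"
      using a fixed by (intro unpinched_eq_0[of _ _ j] free_vectors_single tensor_map_fixed) auto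
    then show ?thesis by (simp add: rel_span_zero)
  next
    case False
    then obtain i where i: "i \<in> {1..n}" and ci: "card (C i) > 1" by auto
    from ci have "C i \<noteq> {}" by auto
    then obtain j where j: "j \<in> C i" by blast
    have ai: "a i \<in> carrier A" using a i by (auto simp: PiE_iff)
    have jk: "j < k" using C[OF i] j by auto
    \<comment> \<open>The summand \<open>z\<close> meets window \<open>j\<close> only and
      \<open>r j (a i)\<close> avoids it, so \<open>C i\<close> becomes \<open>{j}\<close> or
      \<open>C i - {j}\<close>. Both are smaller, as \<open>C i\<close> has at least two
      elements.\<close>
    obtain z where z: "z \<in> carrier A" "a i = z \<oplus>\<^bsub>A\<^esub> r j (a i)" "\<And>k. k \<noteq> j \<Longrightarrow> r k z = z"
      using split[OF ai, of j] by blast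
    have upd: "a(i := x) \<in> {1..n} \<rightarrow>\<^sub>E carrier A" if "x \<in> carrier A" for x
      using a i that by (auto simp: PiE_iff extensional_def)
    have sm: "(\<Sum>l\<in>{1..n}. card ((C(i := D)) l)) < (\<Sum>l\<in>{1..n}. card (C l))"
      if "card D < card (C i)" for D
      using that i by (intro sum_strict_mono_ex1) auto
    have rj: "r j (a i) \<in> carrier A" by (rule linear_maps_closed[OF linear ai])
    have 1: "unpinched r n k (pure_tensor (a(i := z))) \<in> rel_span A n"
    proof (rule less.hyps[of "C(i := {j})"])
      show "(\<Sum>l\<in>{1..n}. card ((C(i := {j})) l)) < (\<Sum>l\<in>{1..n}. card (C l))"
        using ci by (intro sm) simp
    qed (use less.prems(1) upd z C fixed i j jk in \<open>auto split: if_splits\<close>)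
    have 2: "unpinched r n k (pure_tensor (a(i := r j (a i)))) \<in> rel_span A n"
    proof (rule less.hyps[of "C(i := C i - {j})"])
      show "(\<Sum>l\<in>{1..n}. card ((C(i := C i - {j})) l)) < (\<Sum>l\<in>{1..n}. card (C l))"
        using j fin[OF i] by (intro sm card_Diff1_less)
      fix i' j' assume i': "i' \<in> {1..n}" "j' < k" "j' \<notin> (C(i := C i - {j})) i'"
      show "r j' ((a(i := r j (a i))) i') = (a(i := r j (a i))) i'"
      proof (cases "i' = i")
        case True
        show ?thesis
        proof (cases "j' = j")
          case False
          then show ?thesis using True i' fixed[OF i, of j'] comm[OF ai, of j' j] by simp
        qed (use True idem[OF ai] in simp)
      qed (use i' fixed in auto)
    next
      fix i' assume "i' \<in> {1..n}"
      then show "(C(i := C i - {j})) i' \<subseteq> {..<k}" using C by (auto split: if_splits)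
    qed (use less.prems(1) upd[OF rj] in auto)
    have "pure_tensor (a(i := z \<oplus>\<^bsub>A\<^esub> r j (a i))) -
        (pure_tensor (a(i := z)) + pure_tensor (a(i := r j (a i)))) \<in> rel_span A n"
      by (rule rel_span_sum_relation[OF a i z(1) rj])
    then have "unpinched r n k (pure_tensor (a(i := z \<oplus>\<^bsub>A\<^esub> r j (a i))) -
        (pure_tensor (a(i := z)) + pure_tensor (a(i := r j (a i))))) \<in> rel_span A n"
      by (rule tensor_compatible_rel[OF compatible])
    moreover have "a(i := z \<oplus>\<^bsub>A\<^esub> r j (a i)) = a" using z(2) by auto
    ultimately have "unpinched r n k (pure_tensor a) -
        (unpinched r n k (pure_tensor (a(i := z))) + unpinched r n k (pure_tensor (a(i := r j (a i)))))
        \<in> rel_span A n"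
      using tensor_compatible_linear[OF compatible] by (simp add: pmp.linear_diff pmp.linear_add)
    from rel_span_add[OF this rel_span_add[OF 1 2]] show ?thesis by simp
  qed
qed

lemma unpinched_rel_span:
  assumes "n < k" "p \<in> free_vectors A n"
  shows "unpinched r n k p \<in> rel_span A n"
  using tensor_compatible_linear[OF compatible] _ assms(2)
proof (rule rel_span_of_pure_tensors)
  fix a assume "a \<in> {1..n} \<rightarrow>\<^sub>E carrier A"
  then show "unpinched r n k (pure_tensor a) \<in> rel_span A n"
    \<comment> \<open>With all \<open>k\<close> windows in every \<open>C i\<close>, the condition
      on missed windows is vacuous.\<close>
    using assms(1) by (intro unpinched_pure_tensor[where C = "\<lambda>_. {..<k}"]) auto
qed

text \<open>The sum telescopes, each term being the difference of two successive
  \<open>P\<^sub>k p\<close>. The induction runs over a separate bound \<open>N\<close>, since the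
  tensor degree \<open>n\<close> has to stay fixed.\<close>

lemma sum_pinch_unpinched:
  "(\<Sum>k\<le>n. tensor_map n (r k) (unpinched r n k p)) = p - unpinched r n (Suc n) p"
proof -
  have "(\<Sum>k\<le>N. tensor_map n (r k) (unpinched r n k p)) = p - unpinched r n (Suc N) p" for N
    by (induction N) auto
  then show ?thesis .
qed

end

section \<open>The isomorphism between the tensor powers of two algebras with matching
  pinchings\<close>

definition pinch :: "(nat \<Rightarrow> 'a \<Rightarrow> 'b) \<Rightarrow> (nat \<Rightarrow> 'b \<Rightarrow> 'a) \<Rightarrow> nat \<Rightarrow> 'a \<Rightarrow> 'a" where
  "pinch \<alpha> \<beta> k x = \<beta> k (\<alpha> k x)"

text \<open>
  \<open>\<beta> k \<circ> \<alpha> k\<close> and \<open>\<alpha> k \<circ> \<beta> k\<close> are the pinchings of \<open>A\<close> and \<open>B\<close> at window \<open>k\<close>, and \<open>\<alpha> k\<close> and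
  \<open>\<beta> k\<close> are mutually inverse between their images.  The splittings say that an element changes under
  a pinching only within the corresponding window, and that the windows are disjoint.
\<close>

locale pinched_pair =
  fixes A :: "(complex, 'a) module" and B :: "(complex, 'b) module"
    and \<alpha> :: "nat \<Rightarrow> 'a \<Rightarrow> 'b" and \<beta> :: "nat \<Rightarrow> 'b \<Rightarrow> 'a"
  assumes algebra_A: "algebra complex_ring A" and algebra_B: "algebra complex_ring B"
    and hom_\<alpha>: "\<And>k. \<alpha> k \<in> algebra_homs A B" and hom_\<beta>: "\<And>k. \<beta> k \<in> algebra_homs B A"
    and \<alpha>_\<beta>_\<alpha>: "\<And>k x. x \<in> carrier A \<Longrightarrow> \<alpha> k (\<beta> k (\<alpha> k x)) = \<alpha> k x"
    and \<beta>_\<alpha>_\<beta>: "\<And>k y. y \<in> carrier B \<Longrightarrow> \<beta> k (\<alpha> k (\<beta> k y)) = \<beta> k y"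
    and comm_\<alpha>: "\<And>j k x. x \<in> carrier A \<Longrightarrow> \<alpha> k (\<beta> j (\<alpha> j x)) = \<alpha> j (\<beta> j (\<alpha> k x))"
    and comm_\<beta>: "\<And>j k y. y \<in> carrier B \<Longrightarrow> \<beta> k (\<alpha> j (\<beta> j y)) = \<beta> j (\<alpha> j (\<beta> k y))"
    and split_A: "\<And>j x. x \<in> carrier A \<Longrightarrow>
      \<exists>z\<in>carrier A. x = z \<oplus>\<^bsub>A\<^esub> \<beta> j (\<alpha> j x) \<and> (\<forall>k. k \<noteq> j \<longrightarrow> \<beta> k (\<alpha> k z) = z)"
    and split_B: "\<And>j y. y \<in> carrier B \<Longrightarrow>
      \<exists>z\<in>carrier B. y = z \<oplus>\<^bsub>B\<^esub> \<alpha> j (\<beta> j y) \<and> (\<forall>k. k \<noteq> j \<longrightarrow> \<alpha> k (\<beta> k z) = z)"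
begin

text \<open>The axioms are symmetric in the two algebras, so the inverse isomorphism is the same
  construction in the opposite direction.\<close>

lemma swap: "pinched_pair B A \<beta> \<alpha>"
  by (rule pinched_pair.intro; (rule algebra_A algebra_B hom_\<alpha> hom_\<beta> \<alpha>_\<beta>_\<alpha> \<beta>_\<alpha>_\<beta> comm_\<alpha> comm_\<beta>
      split_A split_B; assumption?))

abbreviation "pinch_A \<equiv> pinch \<alpha> \<beta>"
abbreviation "pinch_B \<equiv> pinch \<beta> \<alpha>"

lemma linear_\<alpha>: "\<alpha> k \<in> linear_maps A B" and linear_\<beta>: "\<beta> k \<in> linear_maps B A"
  using hom_\<alpha> hom_\<beta> by (auto simp: algebra_homs_def)

lemma closed_\<alpha>: "x \<in> carrier A \<Longrightarrow> \<alpha> k x \<in> carrier B"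
  and closed_\<beta>: "y \<in> carrier B \<Longrightarrow> \<beta> k y \<in> carrier A"
  using linear_\<alpha> linear_\<beta> by (auto intro: linear_maps_closed)

lemma pinching_family_A: "pinching_family A pinch_A"
proof (rule pinching_family.intro)
  show "pinch_A k \<in> algebra_homs A A" for k
    using algebra_homs_compose[OF hom_\<alpha> hom_\<beta>] by (simp add: pinch_def[abs_def])
  \<comment> \<open>Apply \<open>comm_\<beta>\<close> at \<open>\<alpha> k x\<close>, then
    \<open>comm_\<alpha>\<close> under \<open>\<beta> k\<close>.\<close>
  show "pinch_A j (pinch_A k x) = pinch_A k (pinch_A j x)" if "x \<in> carrier A" for j k x
    unfolding pinch_def by (metis comm_\<alpha> comm_\<beta> closed_\<alpha> that)
qed (auto simp: pinch_def algebra_A \<beta>_\<alpha>_\<beta> closed_\<alpha> intro!: split_A)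

text \<open>The sum may stop at \<open>n\<close>, because for \<open>k > n\<close> the map
  \<open>P\<^sub>k\<close> sends free vectors to relations.\<close>

definition transfer :: "nat \<Rightarrow> ((nat \<Rightarrow> 'a) \<Rightarrow>\<^sub>0 complex) \<Rightarrow> (nat \<Rightarrow> 'b) \<Rightarrow>\<^sub>0 complex" where
  "transfer n p = (\<Sum>k\<le>n. tensor_map n (\<alpha> k) (unpinched pinch_A n k p))"

interpretation swap: pinched_pair B A \<beta> \<alpha> by (rule swap)

interpretation A: pinching_family A pinch_A by (rule pinching_family_A)

interpretation B: pinching_family B pinch_B by (rule swap.pinching_family_A)

lemma tensor_compatible_transfer: "tensor_compatible A n B n (transfer n)"
  unfolding transfer_def[abs_def]
  by (intro tensor_compatible_sum tensor_compatible_compose[OF A.compatible]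
      tensor_compatible_tensor_map linear_\<alpha> A.module)

text \<open>Each summand commutes with multiplication along \<sigma> exactly. The two sides differ
  only in their bounds \<open>m\<close> and \<open>n\<close>, and the terms with
  \<open>m < k\<close> are relations in degree \<open>m\<close>.\<close>

lemma transfer_natural:
  assumes \<sigma>: "\<sigma> \<in> surjections n m" and p: "p \<in> free_vectors A n"
  shows "transfer m (pm_extend (fibre_prods A n m \<sigma>) p)
    - pm_extend (fibre_prods B n m \<sigma>) (transfer n p) \<in> rel_span B m"
proof -
  let ?q = "pm_extend (fibre_prods A n m \<sigma>) p"
  let ?t = "\<lambda>k. tensor_map m (\<alpha> k) (unpinched pinch_A m k ?q)"
  have q: "?q \<in> free_vectors A m"
    by (rule tensor_compatible_free[OF tensor_compatible_fibre_prods[OF algebra_A \<sigma>] p])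
  \<comment> \<open>Surjectivity gives \<open>m \<le> n\<close>, so the sum up to \<open>n\<close>
    can be split at \<open>m\<close>.\<close>
  have "card (\<sigma> ` {1..n}) \<le> card {1..n}" by (rule card_image_le) simp
  then have mn: "m \<le> n" using \<sigma> by (simp add: surjections_def)
  have "pm_extend (fibre_prods B n m \<sigma>) (tensor_map n (\<alpha> k) (unpinched pinch_A n k p)) = ?t k" for k
    by (simp add: unpinched_natural[OF algebra_A A.hom \<sigma> p]
        tensor_map_natural[OF algebra_A hom_\<alpha> \<sigma> A.free_unpinched[OF p]])
  then have "pm_extend (fibre_prods B n m \<sigma>) (transfer n p) = (\<Sum>k\<le>n. ?t k)"
    by (simp add: transfer_def pmp.linear_sum[OF pm_linear_extend])
  also have "\<dots> = transfer m ?q + (\<Sum>k\<in>{m<..n}. ?t k)"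
    unfolding transfer_def using mn
    by (subst sum.union_disjoint[symmetric]) (auto intro!: sum.cong)
  finally have "transfer m ?q - pm_extend (fibre_prods B n m \<sigma>) (transfer n p) =
      0 - (\<Sum>k\<in>{m<..n}. ?t k)"
    by simp
  also have "\<dots> \<in> rel_span B m"
    by (intro rel_span_diff rel_span_zero rel_span_sum
        tensor_compatible_rel[OF tensor_compatible_tensor_map[OF linear_\<alpha> A.module]]
        A.unpinched_rel_span q) simp
  finally show ?thesis .
qed

text \<open>In the double sum the mixed terms vanish, and the diagonal ones telescope to
  \<open>p\<close> minus \<open>unpinched pinch_A n (Suc n) p\<close>, which is a relation.\<close>

lemma transfer_inverse:
  assumes p: "p \<in> free_vectors A n"
  shows "swap.transfer n (transfer n p) - p \<in> rel_span A n"
proof -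
  let ?P = "\<lambda>k. unpinched pinch_A n k p"
  let ?Q = "\<lambda>k. tensor_map n (\<alpha> k) (?P k)"
  have P: "?P k \<in> free_vectors A n" for k by (rule A.free_unpinched[OF p])
  have Q: "?Q k \<in> free_vectors B n" for k
    by (rule tensor_compatible_free[OF tensor_compatible_tensor_map[OF linear_\<alpha> A.module] P])
  have off_diagonal: "tensor_map n (\<beta> l) (unpinched pinch_B n l (?Q k)) = 0" if "k \<noteq> l" for k l
  proof (cases "k < l")
    case True
    \<comment> \<open>\<open>?Q k\<close> lies in the image of \<open>\<alpha> k\<close>, so
      pinching \<open>k\<close> of \<open>B\<close> fixes it; as \<open>k < l\<close>, one factor of
      \<open>P\<^sub>l\<close> kills it.\<close>
    have "tensor_map n (pinch_B k) (?Q k) = ?Q k"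
      unfolding tensor_map_comp
      by (rule tensor_map_cong[OF P]) (simp add: pinch_def \<alpha>_\<beta>_\<alpha>)
    then have "unpinched pinch_B n l (?Q k) = 0"
      using Q True by (intro B.unpinched_eq_0)
    then show ?thesis by (simp add: pmp.linear_0[OF pm_linear_tensor_map])
  next
    case False
    \<comment> \<open>Now \<open>l < k\<close>. The composite of \<open>\<alpha> k\<close> and
      \<open>\<beta> l\<close> does not change if preceded by pinching \<open>l\<close>, and
      pinching \<open>l\<close> kills \<open>?P k\<close>.\<close>
    have "tensor_map n (\<beta> l) (?Q k) = tensor_map n (\<lambda>x. \<beta> l (\<alpha> k x)) (tensor_map n (pinch_A l) (?P k))"
      unfolding tensor_map_comp
    proof (rule tensor_map_cong[OF P])
      fix x assume x: "x \<in> carrier A"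
      show "\<beta> l (\<alpha> k x) = \<beta> l (\<alpha> k (pinch_A l x))"
        using comm_\<alpha>[OF x, of k l] \<beta>_\<alpha>_\<beta>[OF closed_\<alpha>[OF x], of l k] by (simp add: pinch_def)
    qed
    then have "tensor_map n (\<beta> l) (?Q k) = 0"
      using False that A.pinch_unpinched[OF p, of l k]
      by (simp add: pmp.linear_0[OF pm_linear_tensor_map])
    moreover have "tensor_map n (\<beta> l) (unpinched pinch_B n l (?Q k)) =
        unpinched pinch_A n l (tensor_map n (\<beta> l) (?Q k))"
      by (rule tensor_map_unpinched[OF linear_\<beta> B.module B.linear _ Q])
         (simp add: pinch_def comm_\<beta>)
    ultimately show ?thesis
      using pmp.linear_0[OF tensor_compatible_linear[OF A.compatible]] by simp
  qed
  \<comment> \<open>Moving \<open>\<alpha> k\<close> to the outside leaves \<open>P\<^sub>k\<close>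
    applied twice. It fixes its own image, because the pinchings \<open>l < k\<close> vanish
    there.\<close>
  have diagonal: "tensor_map n (\<beta> k) (unpinched pinch_B n k (?Q k)) =
      tensor_map n (pinch_A k) (?P k)" for k
  proof -
    have "unpinched pinch_B n k (?Q k) = tensor_map n (\<alpha> k) (unpinched pinch_A n k (?P k))"
      by (rule tensor_map_unpinched[OF linear_\<alpha> A.module A.linear _ P, symmetric])
         (simp add: pinch_def comm_\<alpha>)
    also have "unpinched pinch_A n k (?P k) = ?P k"
      by (rule A.unpinched_eq_self) (rule A.pinch_unpinched[OF p])
    finally show ?thesis by (simp add: tensor_map_comp pinch_def[abs_def])
  qed
  have "swap.transfer n (transfer n p) =
      (\<Sum>l\<le>n. \<Sum>k\<le>n. tensor_map n (\<beta> l) (unpinched pinch_B n l (?Q k)))"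
    unfolding swap.transfer_def transfer_def
    by (simp add: pmp.linear_sum[OF pm_linear_tensor_map]
        pmp.linear_sum[OF tensor_compatible_linear[OF B.compatible]])
  also have "\<dots> = (\<Sum>l\<le>n. \<Sum>k\<le>n. if k = l then tensor_map n (pinch_A l) (?P l) else 0)"
    by (intro sum.cong refl) (auto simp: off_diagonal diagonal)
  also have "\<dots> = p - unpinched pinch_A n (Suc n) p"
    by (simp add: A.sum_pinch_unpinched del: unpinched.simps)
  finally have "swap.transfer n (transfer n p) - p = 0 - unpinched pinch_A n (Suc n) p"
    by simp
  also have "\<dots> \<in> rel_span A n"
    using p by (intro rel_span_diff rel_span_zero A.unpinched_rel_span) simp
  finally show ?thesis .
qed

end

context pinched_pair
begin

interpretation swap: pinched_pair B A \<beta> \<alpha> by (rule swap)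

lemma induced_transfer_iso:
  "induced_map B n (transfer n) \<in> linear_isos (tensor_power A n) (tensor_power B n)"
proof -
  have 1: "induced_map B n (transfer n) \<in> linear_maps (tensor_power A n) (tensor_power B n)"
    by (rule induced_map_linear[OF tensor_compatible_transfer])
  have 2: "induced_map A n (swap.transfer n) \<in> linear_maps (tensor_power B n) (tensor_power A n)"
    by (rule induced_map_linear[OF swap.tensor_compatible_transfer])
  have "bij_betw (induced_map B n (transfer n)) (carrier (tensor_power A n)) (carrier (tensor_power B n))"
  proof (rule bij_betwI[where g = "induced_map A n (swap.transfer n)"])
    fix U assume "U \<in> carrier (tensor_power A n)"
    then obtain p where p: "p \<in> free_vectors A n" "U = tensor_class A n p"
      by (auto simp: carrier_tensor_power)
    show "induced_map A n (swap.transfer n) (induced_map B n (transfer n) U) = U"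
      using transfer_inverse[OF p(1)]
      by (simp add: p induced_map_class[OF tensor_compatible_transfer]
          induced_map_class[OF swap.tensor_compatible_transfer] tensor_class_eq_iff)
  next
    fix U assume "U \<in> carrier (tensor_power B n)"
    then obtain p where p: "p \<in> free_vectors B n" "U = tensor_class B n p"
      by (auto simp: carrier_tensor_power)
    show "induced_map B n (transfer n) (induced_map A n (swap.transfer n) U) = U"
      using swap.transfer_inverse[OF p(1)]
      by (simp add: p induced_map_class[OF tensor_compatible_transfer]
          induced_map_class[OF swap.tensor_compatible_transfer] tensor_class_eq_iff)
  qed (use 1 2 in \<open>auto simp: linear_maps_def\<close>)
  with 1 show ?thesis by (simp add: linear_isos_def)
qed

theorem naturally_isomorphic_loday: "naturally_isomorphic (loday A) (loday B)"
  unfolding naturally_isomorphic_def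
proof (intro conjI exI[of _ "\<lambda>n. induced_map B n (transfer n)"] allI impI ballI)
  fix n m \<sigma> v
  assume \<sigma>: "\<sigma> \<in> surjections n m" and "v \<in> carrier (obj (loday A) n)"
  then obtain p where "p \<in> free_vectors A n" "v = tensor_class A n p"
    by (auto simp: obj_loday carrier_tensor_power)
  then show "induced_map B m (transfer m) (arr (loday A) n m \<sigma> v) =
      arr (loday B) n m \<sigma> (induced_map B n (transfer n) v)"
    using transfer_natural[OF \<sigma>]
    by (simp add: arr_loday tensor_class_eq_iff induced_map_class[OF tensor_compatible_transfer]
        induced_map_class[OF tensor_compatible_fibre_prods[OF algebra_A \<sigma>]]
        induced_map_class[OF tensor_compatible_fibre_prods[OF algebra_B \<sigma>]])
qed (simp_all add: is_omega_functor_loday algebra_A algebra_B obj_loday induced_transfer_iso)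

end


section \<open>Continuous functions on quotient spaces\<close>

lemma carrier_continuous_functions:
  "f \<in> carrier (continuous_functions T) \<longleftrightarrow>
    f \<in> extensional (topspace T) \<and> continuous_map T euclidean f"
  by (simp add: continuous_functions_def)

definition pullback :: "'p topology \<Rightarrow> ('p \<Rightarrow> 'q) \<Rightarrow> ('q \<Rightarrow> complex) \<Rightarrow> 'p \<Rightarrow> complex" where
  "pullback S g f = (\<lambda>x\<in>topspace S. f (g x))"

lemma pullback_hom:
  assumes g: "continuous_map S T g"
  shows "pullback S g \<in> algebra_homs (continuous_functions T) (continuous_functions S)"
proof -
  have gT: "g x \<in> topspace T" if "x \<in> topspace S" for x
    using g that by (auto simp: continuous_map_def Pi_iff)
  have "continuous_map S euclidean (\<lambda>x. f (g x))" if "continuous_map T euclidean f" for f :: "_ \<Rightarrow> complex"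
    using continuous_map_compose[OF g that] by (simp add: o_def)
  then show ?thesis
    using gT by (auto simp: algebra_homs_def linear_maps_def continuous_functions_def pullback_def fun_eq_iff)
qed

section \<open>Functions on quotient spaces and maps between them\<close>

lemma quotient_class_eq_iff:
  assumes "p \<in> topspace T" "q \<in> topspace T"
  shows "quotient_class T r p = quotient_class T r q \<longleftrightarrow> equivclp r p q"
proof
  assume eq: "quotient_class T r p = quotient_class T r q"
  have "q \<in> quotient_class T r p" unfolding eq using assms by (simp add: quotient_class_def)
  then show "equivclp r p q" by (simp add: quotient_class_def)
next
  assume "equivclp r p q"
  then show "quotient_class T r p = quotient_class T r q"
    unfolding quotient_class_def by (intro Collect_cong) (meson equivclp_sym equivclp_trans)
qed

lemma quotient_class_inv_into:
  assumes "p \<in> topspace T"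
  shows "inv_into (topspace T) (quotient_class T r) (quotient_class T r p) \<in> topspace T"
    and "equivclp r (inv_into (topspace T) (quotient_class T r) (quotient_class T r p)) p"
proof -
  let ?p' = "inv_into (topspace T) (quotient_class T r) (quotient_class T r p)"
  have c: "quotient_class T r p \<in> quotient_class T r ` topspace T" using assms by simp
  then show p': "?p' \<in> topspace T" by (rule inv_into_into)
  have "quotient_class T r ?p' = quotient_class T r p" using c by (rule f_inv_into_f)
  then show "equivclp r ?p' p" using quotient_class_eq_iff[OF p' assms] by simp
qed

lemma equivclp_map:
  assumes "\<And>p q. r p q \<Longrightarrow> equivclp s (g p) (g q)" "equivclp r p q"
  shows "equivclp s (g p) (g q)"
  using assms(2)
proof (induction rule: equivclp_induct)
  case (step y z)
  then show ?case using assms(1) by (meson equivclp_sym equivclp_trans)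
qed simp

text \<open>Each point belongs to at most one related pair, so a chain of generators never leads
  beyond the partner of its starting point. Both gluings are of this kind.\<close>

lemma equivclp_matching:
  assumes "\<And>p q q'. r p q \<Longrightarrow> r p q' \<Longrightarrow> q = q'" "\<And>p p' q. r p q \<Longrightarrow> r p' q \<Longrightarrow> p = p'"
    and "\<And>p q s. r p q \<Longrightarrow> \<not> r q s"
  shows "equivclp r p q \<longleftrightarrow> p = q \<or> r p q \<or> r q p"
proof
  assume "equivclp r p q"
  then show "p = q \<or> r p q \<or> r q p"
    by (induction rule: equivclp_induct) (use assms in blast)+
qed auto

lemma quotient_function:
  fixes u :: "'p \<Rightarrow> complex"
  assumes "continuous_map T euclidean u" "\<And>p q. r p q \<Longrightarrow> u p = u q"
  shows "\<exists>f\<in>carrier (continuous_functions (quotient_space T r)).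
    \<forall>p\<in>topspace T. f (quotient_class T r p) = u p"
proof -
  let ?Q = "quotient_space T r"
  define f where "f = (\<lambda>c\<in>topspace ?Q. u (inv_into (topspace T) (quotient_class T r) c))"
  have u: "u p = u q" if "equivclp r p q" for p q
    using that by (induction rule: equivclp_induct) (use assms(2) in auto)
  have f: "f (quotient_class T r p) = u p" if p: "p \<in> topspace T" for p
    using u[OF quotient_class_inv_into(2)[OF p]] p by (simp add: f_def topspace_quotient_space)
  have "continuous_map T euclidean (f \<circ> quotient_class T r)"
    using assms(1) by (rule continuous_map_eq) (simp add: f)
  then have "continuous_map ?Q euclidean f"
    by (rule continuous_compose_quotient_map[OF quotient_map_quotient_class])
  then show ?thesis
    using f by (intro bexI[of _ f]) (simp_all add: carrier_continuous_functions f_def)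
qed

text \<open>The value is computed at an arbitrary representative; this is the induced map of
  quotients once \<open>g\<close> carries \<open>r\<close> to \<open>s\<close>.\<close>

definition quotient_lift :: "'p topology \<Rightarrow> ('p \<Rightarrow> 'p \<Rightarrow> bool) \<Rightarrow> ('p \<Rightarrow> 'p \<Rightarrow> bool) \<Rightarrow>
    ('p \<Rightarrow> 'p) \<Rightarrow> 'p set \<Rightarrow> 'p set" where
  "quotient_lift T r s g c = quotient_class T s (g (inv_into (topspace T) (quotient_class T r) c))"

lemma
  assumes g: "continuous_map T T g" and rs: "\<And>p q. r p q \<Longrightarrow> s (g p) (g q)"
  shows quotient_lift_class: "p \<in> topspace T \<Longrightarrow>
      quotient_lift T r s g (quotient_class T r p) = quotient_class T s (g p)"
    and continuous_quotient_lift: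
      "continuous_map (quotient_space T r) (quotient_space T s) (quotient_lift T r s g)"
proof -
  have gT: "g p \<in> topspace T" if "p \<in> topspace T" for p
    using g that by (auto simp: continuous_map_def Pi_iff)
  show *: "quotient_lift T r s g (quotient_class T r p) = quotient_class T s (g p)"
    if p: "p \<in> topspace T" for p
  proof -
    have "equivclp s (g (inv_into (topspace T) (quotient_class T r) (quotient_class T r p))) (g p)"
      by (rule equivclp_map[OF _ quotient_class_inv_into(2)[OF p]]) (blast dest: rs)
    then show ?thesis
      unfolding quotient_lift_def
      using quotient_class_eq_iff[OF gT[OF quotient_class_inv_into(1)[OF p]] gT[OF p]] by simp
  qed
  have "continuous_map T (quotient_space T s) (quotient_class T s \<circ> g)"
    by (rule continuous_map_compose[OF g quotient_imp_continuous_map[OF quotient_map_quotient_class]])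
  then have "continuous_map T (quotient_space T s) (quotient_lift T r s g \<circ> quotient_class T r)"
    by (rule continuous_map_eq) (simp add: *)
  then show "continuous_map (quotient_space T r) (quotient_space T s) (quotient_lift T r s g)"
    by (rule continuous_compose_quotient_map[OF quotient_map_quotient_class])
qed

lemma continuous_functions_quotient_eqI:
  assumes "f \<in> carrier (continuous_functions (quotient_space T r))"
    "g \<in> carrier (continuous_functions (quotient_space T r))"
    "\<And>p. p \<in> topspace T \<Longrightarrow> f (quotient_class T r p) = g (quotient_class T r p)"
  shows "f = g"
  using assms(1,2)
  by (intro extensionalityI[of f "topspace (quotient_space T r)"])
     (auto simp: carrier_continuous_functions topspace_quotient_space assms(3))

text \<open>Evaluating at classes turns the hypotheses on points into the axioms on functions.
  Pullback reverses arrows: functions on the \<open>r\<close>-quotient are carried over by the lift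
  from \<open>s\<close> to \<open>r\<close>.\<close>

lemma pinched_pair_quotient:
  fixes T :: "'p topology" and f :: "nat \<Rightarrow> 'p \<Rightarrow> 'p"
  assumes f: "\<And>k. continuous_map T T (f k)"
    and rs: "\<And>k p q. r p q \<Longrightarrow> s (f k p) (f k q)" and sr: "\<And>k p q. s p q \<Longrightarrow> r (f k p) (f k q)"
    and cube: "\<And>k p. p \<in> topspace T \<Longrightarrow> f k (f k (f k p)) = f k p"
    and comm: "\<And>j k p. p \<in> topspace T \<Longrightarrow> f k (f j (f j p)) = f j (f j (f k p))"
    and disjoint: "\<And>j k p. p \<in> topspace T \<Longrightarrow> j \<noteq> k \<Longrightarrow> f j (f j p) = p \<or> f k (f k p) = p"
  shows "pinched_pair (continuous_functions (quotient_space T r))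
    (continuous_functions (quotient_space T s))
    (\<lambda>k. pullback (quotient_space T s) (quotient_lift T s r (f k)))
    (\<lambda>k. pullback (quotient_space T r) (quotient_lift T r s (f k)))"
proof -
  have fT: "f k p \<in> topspace T" if "p \<in> topspace T" for k p
    using f that by (auto simp: continuous_map_def Pi_iff)
  \<comment> \<open>\<open>R\<close>, \<open>C\<close> and \<open>P\<close> take the relations as
    arguments, so that each fact below serves both directions.\<close>
  define R where "R r s \<longleftrightarrow> (\<forall>k p q. r p q \<longrightarrow> s (f k p) (f k q))" for r s
  define C where "C r = continuous_functions (quotient_space T r)" for r
  define P where "P r s k = pullback (quotient_space T r) (quotient_lift T r s (f k))" for r s k
  have hom: "P r s k \<in> algebra_homs (C s) (C r)" if "R r s" for r s k
    unfolding P_def C_def by (rule pullback_hom, rule continuous_quotient_lift) (use f that in \<open>auto simp: R_def\<close>)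
  have val: "P r s k a (quotient_class T r p) = a (quotient_class T s (f k p))"
    if "R r s" "p \<in> topspace T" for r s k a p
    unfolding P_def pullback_def using that f
    by (simp add: topspace_quotient_space quotient_lift_class R_def)
  have closed: "P r s k a \<in> carrier (C r)" if "R r s" "a \<in> carrier (C s)"
    for r s k a
  proof -
    have "P r s k \<in> linear_maps (C s) (C r)" using hom[OF that(1)] by (simp add: algebra_homs_def)
    then show ?thesis using that(2) by (rule linear_maps_closed)
  qed
  have eqI: "a = b" if "a \<in> carrier (C r)" "b \<in> carrier (C r)"
    "\<And>p. p \<in> topspace T \<Longrightarrow> a (quotient_class T r p) = b (quotient_class T r p)" for r a b
    using that unfolding C_def by (rule continuous_functions_quotient_eqI)
  have half: "P r s k (P s r k (P r s k a)) = P r s k a"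
      "P r s k (P s r j (P r s j a)) = P r s j (P s r j (P r s k a))"
    if rs: "R r s" and sr: "R s r"
      and a: "a \<in> carrier (C s)" for r s k j a
  proof -
    note c = closed[OF rs] closed[OF sr]
    show "P r s k (P s r k (P r s k a)) = P r s k a"
      by (rule eqI[of _ r]) (simp_all add: c a val[OF rs] val[OF sr] fT cube)
    show "P r s k (P s r j (P r s j a)) = P r s j (P s r j (P r s k a))"
      by (rule eqI[of _ r]) (simp_all add: c a val[OF rs] val[OF sr] fT comm)
  qed
  have split: "\<exists>z\<in>carrier (C s). a = z \<oplus>\<^bsub>C s\<^esub> P s r j (P r s j a) \<and>
      (\<forall>k. k \<noteq> j \<longrightarrow> P s r k (P r s k z) = z)"
    if rs: "R r s" and sr: "R s r"
      and a: "a \<in> carrier (C s)" for r s j a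
  proof (intro bexI conjI allI impI)
    let ?z = "\<lambda>c\<in>topspace (quotient_space T s). a c - P s r j (P r s j a) c"
    note c = closed[OF rs] closed[OF sr]
    have b: "P s r j (P r s j a) \<in> carrier (C s)" using c a by simp
    show z: "?z \<in> carrier (C s)"
      using a b by (auto simp: C_def carrier_continuous_functions intro: continuous_map_diff)
    show "a = ?z \<oplus>\<^bsub>C s\<^esub> P s r j (P r s j a)"
      using a by (auto simp: C_def continuous_functions_def fun_eq_iff extensional_def)
    have zval: "?z (quotient_class T s p) =
        a (quotient_class T s p) - a (quotient_class T s (f j (f j p)))" if "p \<in> topspace T" for p
      using that by (simp add: topspace_quotient_space val[OF rs] val[OF sr] fT)
    fix k assume kj: "k \<noteq> j"
    show "P s r k (P r s k ?z) = ?z"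
    proof (rule eqI[of _ s])
      fix p assume p: "p \<in> topspace T"
      \<comment> \<open>If \<open>f k (f k p) = p\<close>, the two values agree trivially. If
        \<open>f j (f j p) = p\<close>, then \<open>?z\<close> is zero at \<open>p\<close> and, by
        this commutation, also at \<open>f k (f k p)\<close>.\<close>
      have "f j (f j (f k (f k p))) = f k (f k (f j (f j p)))"
        using comm[of p k j] comm[of "f k p" k j] p fT by simp
      then show "P s r k (P r s k ?z) (quotient_class T s p) = ?z (quotient_class T s p)"
        using disjoint[OF p kj] p
        by (auto simp: val[OF rs] val[OF sr] fT zval simp del: restrict_apply)
    qed (use c z in auto)
  qed
  have alg: "algebra complex_ring (C r)" for r
    unfolding C_def by (rule algebra_continuous_functions)
  have "pinched_pair (C r) (C s) (P s r) (P r s)"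
    using rs sr by (intro pinched_pair.intro alg hom half split) (auto simp: R_def)
  then show ?thesis by (simp only: C_def P_def[abs_def])
qed


section \<open>Pinching the strips\<close>

abbreviation unit_interval_square :: "(real \<times> real) set" where
  "unit_interval_square \<equiv> {0..1} \<times> {0..1}"

abbreviation cylinder_rel :: "real \<times> real \<Rightarrow> real \<times> real \<Rightarrow> bool" where
  "cylinder_rel \<equiv> \<lambda>p q. \<exists>y\<in>{0..1}. p = (0, y) \<and> q = (1, y)"

abbreviation moebius_rel :: "real \<times> real \<Rightarrow> real \<times> real \<Rightarrow> bool" where
  "moebius_rel \<equiv> \<lambda>p q. \<exists>y\<in>{0..1}. p = (0, y) \<and> q = (1, 1 - y)"

text \<open>Truncating, rather than rescaling, makes the squeezing idempotent and lets squeezings of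
  different radii commute.\<close>

definition clamp_mid :: "real \<Rightarrow> real \<Rightarrow> real" where
  "clamp_mid \<rho> y = max (1/2 - \<rho>) (min (1/2 + \<rho>) y)"

lemma clamp_mid_reflect: "0 \<le> \<rho> \<Longrightarrow> clamp_mid \<rho> (1 - y) = 1 - clamp_mid \<rho> y"
  and clamp_mid_idem: "0 \<le> \<rho> \<Longrightarrow> clamp_mid \<rho> (clamp_mid \<rho> y) = clamp_mid \<rho> y"
  and clamp_mid_commute:
    "0 \<le> \<rho> \<Longrightarrow> 0 \<le> \<rho>' \<Longrightarrow> clamp_mid \<rho> (clamp_mid \<rho>' y) = clamp_mid \<rho>' (clamp_mid \<rho> y)"
  and clamp_mid_half: "\<rho> = 1/2 \<Longrightarrow> y \<in> {0..1} \<Longrightarrow> clamp_mid \<rho> y = y"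
  and clamp_mid_mem: "0 \<le> \<rho> \<Longrightarrow> \<rho> \<le> 1/2 \<Longrightarrow> clamp_mid \<rho> y \<in> {0..1}"
  by (auto simp: clamp_mid_def max_def min_def)

definition window_centre :: "nat \<Rightarrow> real" where
  "window_centre k = (1/2) ^ Suc k"

text \<open>Half the height that is left of the fibre over \<open>x\<close>: zero at the centre, and
  the full \<open>1/2\<close> from distance \<open>window_centre k / 4\<close> on, which is where
  the window ends.\<close>

definition window_radius :: "nat \<Rightarrow> real \<Rightarrow> real" where
  "window_radius k x = min (1/2) (2 * \<bar>x - window_centre k\<bar> / window_centre k)"

definition twist :: "nat \<Rightarrow> real \<times> real \<Rightarrow> real \<times> real" where
  "twist k p = (fst p, if fst p \<le> window_centre k then clamp_mid (window_radius k (fst p)) (snd p)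
     else 1 - clamp_mid (window_radius k (fst p)) (snd p))"

lemma window_centre_pos: "0 < window_centre k" and window_centre_le: "window_centre k \<le> 1/2"
  by (simp_all add: window_centre_def power_le_one)

lemma window_radius_nonneg: "0 \<le> window_radius k x" and window_radius_le: "window_radius k x \<le> 1/2"
  using window_centre_pos[of k] by (auto simp: window_radius_def)

lemma window_radius_eq_half:
  "window_radius k x = 1/2 \<longleftrightarrow> window_centre k / 4 \<le> \<bar>x - window_centre k\<bar>"
  using window_centre_pos[of k] by (auto simp: window_radius_def min_def field_simps)

lemma windows_disjoint:
  assumes "j \<noteq> k"
  shows "window_radius j x = 1/2 \<or> window_radius k x = 1/2"
proof -
  have *: "window_radius j x = 1/2 \<or> window_radius k x = 1/2" if "j < k" for j k
  proof -
    \<comment> \<open>This compares twice the centre of window \<open>k\<close> with the centre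
      \<open>c\<close> of window \<open>j\<close>. So window \<open>k\<close> ends at or before
      \<open>5/8 * c\<close>, whereas window \<open>j\<close> begins at
      \<open>3/4 * c\<close>.\<close>
    have "(1/2::real) ^ k \<le> (1/2) ^ Suc j" using that by (intro power_decreasing) auto
    then have "2 * window_centre k \<le> window_centre j" by (simp add: window_centre_def)
    then show ?thesis
      using window_centre_pos[of k] unfolding window_radius_eq_half by linarith
  qed
  show ?thesis using *[of j k] *[of k j] assms by linarith
qed

lemma twist_twist: "twist k (twist k p) = (fst p, clamp_mid (window_radius k (fst p)) (snd p))"
  using window_radius_nonneg[of k "fst p"]
  by (simp add: twist_def clamp_mid_reflect clamp_mid_idem)

lemma twist_cube: "twist k (twist k (twist k p)) = twist k p"
  using window_radius_nonneg[of k "fst p"]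
  by (simp add: twist_twist) (simp add: twist_def clamp_mid_reflect clamp_mid_idem)

lemma twist_comm: "twist k (twist j (twist j p)) = twist j (twist j (twist k p))"
  using window_radius_nonneg[of k "fst p"] window_radius_nonneg[of j "fst p"]
  by (simp add: twist_twist)
     (simp add: twist_def clamp_mid_reflect clamp_mid_commute[of "window_radius k (fst p)"])

lemma twist_disjoint:
  assumes "p \<in> unit_interval_square" "j \<noteq> k"
  shows "twist j (twist j p) = p \<or> twist k (twist k p) = p"
proof -
  have "snd p \<in> {0..1}" using assms(1) by auto
  then show ?thesis
    using windows_disjoint[OF assms(2), of "fst p"] clamp_mid_half by (metis twist_twist prod.collapse)
qed

text \<open>Both vertical edges are outside every window but on different sides of the centre, so
  only the right one is flipped. This is what exchanges the two gluings.\<close>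

lemma twist_left: "y \<in> {0..1} \<Longrightarrow> twist k (0, y) = (0, y)"
  and twist_right: "y \<in> {0..1} \<Longrightarrow> twist k (1, y) = (1, 1 - y)"
proof -
  have "window_radius k 0 = 1/2" "window_radius k 1 = 1/2"
    unfolding window_radius_eq_half using window_centre_pos[of k] window_centre_le[of k] by auto
  then have "clamp_mid (window_radius k 0) y = y" "clamp_mid (window_radius k 1) y = y"
    if "y \<in> {0..1}" using that clamp_mid_half by blast+
  then show "y \<in> {0..1} \<Longrightarrow> twist k (0, y) = (0, y)" "y \<in> {0..1} \<Longrightarrow> twist k (1, y) = (1, 1 - y)"
    using window_centre_pos[of k] window_centre_le[of k] by (simp_all add: twist_def)
qed

lemma continuous_twist: "continuous_map unit_square unit_square (twist k)"
proof -
  have c: "window_centre k \<noteq> 0" using window_centre_pos[of k] by simp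
  \<comment> \<open>Where the branches meet, the radius is zero and both give the midpoint
    \<open>1/2\<close>.\<close>
  have "continuous_on unit_interval_square
      (\<lambda>p. if fst p \<le> window_centre k then clamp_mid (window_radius k (fst p)) (snd p)
        else 1 - clamp_mid (window_radius k (fst p)) (snd p))"
    unfolding clamp_mid_def window_radius_def
    by (intro continuous_on_cases_le continuous_intros)
       (use c in \<open>auto simp: max_def min_def\<close>)
  then have "continuous_on unit_interval_square (twist k)"
    unfolding twist_def[abs_def] by (intro continuous_on_Pair continuous_intros)
  moreover have "twist k p \<in> unit_interval_square" if "p \<in> unit_interval_square" for p
    using clamp_mid_mem[OF window_radius_nonneg window_radius_le, of k "fst p" "snd p"] that
    by (auto simp: twist_def)
  ultimately show ?thesis by auto
qed

lemma naturally_isomorphic_cylinder_moebius: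
  "naturally_isomorphic (loday (continuous_functions cylinder))
    (loday (continuous_functions moebius_strip))"
proof -
  have "pinched_pair (continuous_functions cylinder) (continuous_functions moebius_strip)
      (\<lambda>k. pullback moebius_strip (quotient_lift unit_square moebius_rel cylinder_rel (twist k)))
      (\<lambda>k. pullback cylinder (quotient_lift unit_square cylinder_rel moebius_rel (twist k)))"
    unfolding cylinder_def moebius_strip_def
  proof (rule pinched_pair_quotient)
    show "moebius_rel (twist k p) (twist k q)" if "cylinder_rel p q" for k p q
      using that by (auto simp: twist_left twist_right)
    show "cylinder_rel (twist k p) (twist k q)" if "moebius_rel p q" for k p q
      using that by (auto simp: twist_left twist_right)
    show "twist j (twist j p) = p \<or> twist k (twist k p) = p"
      if "p \<in> topspace unit_square" "j \<noteq> k" for j k p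
      using that by (intro twist_disjoint) auto
  qed (simp_all only: continuous_twist twist_cube twist_comm)
  then show ?thesis by (rule pinched_pair.naturally_isomorphic_loday)
qed


section \<open>The algebras are not isomorphic\<close>

text \<open>Evaluation at \<open>t\<close> after \<open>F\<close> is evaluation at the point of
  \<open>S\<close> where \<open>e\<close> has the value \<open>F e t\<close>. As \<open>F\<close> is
  onto, \<open>F e t\<close> thus determines the values at \<open>t\<close> of all functions on
  \<open>T\<close>, and these determine \<open>t\<close>.\<close>

lemma algebra_iso_injective:
  assumes F: "F \<in> linear_isos (continuous_functions S) (continuous_functions T)"
    and mult: "\<And>f g. f \<in> carrier (continuous_functions S) \<Longrightarrow> g \<in> carrier (continuous_functions S) \<Longrightarrow>
      F (f \<otimes>\<^bsub>continuous_functions S\<^esub> g) = F f \<otimes>\<^bsub>continuous_functions T\<^esub> F g"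
    and e: "e \<in> carrier (continuous_functions S)" and inj: "inj_on e (topspace S)"
    and sep: "\<And>p q. p \<in> topspace T \<Longrightarrow> q \<in> topspace T \<Longrightarrow> p \<noteq> q \<Longrightarrow>
      \<exists>f\<in>carrier (continuous_functions T). f p \<noteq> f q"
  shows "inj_on (F e) (topspace T)"
proof (rule inj_onI, rule ccontr)
  let ?A = "continuous_functions S" and ?B = "continuous_functions T"
  fix p q assume p: "p \<in> topspace T" and q: "q \<in> topspace T" and eq: "F e p = F e q" and "p \<noteq> q"
  have bij: "bij_betw F (carrier ?A) (carrier ?B)" and lin: "F \<in> linear_maps ?A ?B"
    using F by (auto simp: linear_isos_def)
  have surj: "\<exists>f\<in>carrier ?A. F f = g" if "g \<in> carrier ?B" for g
    using bij_betw_apply[OF bij_betw_inv_into[OF bij] that] bij_betw_inv_into_right[OF bij that] by blast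
  have mult': "F (\<lambda>x\<in>topspace S. f x * g x) t = F f t * F g t"
    if "f \<in> carrier ?A" "g \<in> carrier ?A" "t \<in> topspace T" for f g t
    using fun_cong[OF mult[OF that(1,2)], of t] that(3) by (simp add: continuous_functions_def)
  have add': "F (\<lambda>x\<in>topspace S. f x + g x) t = F f t + F g t"
    if "f \<in> carrier ?A" "g \<in> carrier ?A" "t \<in> topspace T" for f g t
  proof -
    have "F (f \<oplus>\<^bsub>?A\<^esub> g) = F f \<oplus>\<^bsub>?B\<^esub> F g" using lin that by (auto simp: linear_maps_def)
    from fun_cong[OF this, of t] show ?thesis using that(3) by (simp add: continuous_functions_def)
  qed
  have smult': "F (\<lambda>x\<in>topspace S. c * f x) t = c * F f t"
    if "f \<in> carrier ?A" "t \<in> topspace T" for c f t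
  proof -
    have "F (c \<odot>\<^bsub>?A\<^esub> f) = c \<odot>\<^bsub>?B\<^esub> F f" using lin that by (auto simp: linear_maps_def)
    from fun_cong[OF this, of t] show ?thesis using that(2) by (simp add: continuous_functions_def)
  qed
  have carrierI: "(\<lambda>x\<in>topspace S. u x) \<in> carrier ?A" if "continuous_map S euclidean u" for u
    using that by (simp add: carrier_continuous_functions)
  have cont: "continuous_map S euclidean f" if "f \<in> carrier ?A" for f
    using that by (simp add: carrier_continuous_functions)
  define i where "i = (\<lambda>x\<in>topspace S. 1::complex)"
  have i: "i \<in> carrier ?A" unfolding i_def by (rule carrierI) simp
  \<comment> \<open>Some \<open>f\<close> has image one because \<open>F\<close> is onto, and the
    product of \<open>i\<close> and \<open>f\<close> is \<open>f\<close>.\<close>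
  have Fi: "F i t = 1" if t: "t \<in> topspace T" for t
  proof -
    have "(\<lambda>x\<in>topspace T. 1) \<in> carrier ?B" by (simp add: carrier_continuous_functions)
    from surj[OF this] obtain f where f: "f \<in> carrier ?A" "F f = (\<lambda>x\<in>topspace T. 1)"
      by blast
    have "(\<lambda>x\<in>topspace S. i x * f x) = f"
      using f(1) by (auto simp: i_def carrier_continuous_functions extensional_def)
    then show ?thesis using mult'[OF i f(1) t] f(2) t by simp
  qed
  \<comment> \<open>A function without zeros is invertible; hence so is its image, which then has no
    zeros either.\<close>
  have nonvanishing: "\<exists>x\<in>topspace S. u x = 0"
    if u: "u \<in> carrier ?A" and "t \<in> topspace T" "F u t = 0" for u t
  proof (rule ccontr)
    assume nz: "\<not> (\<exists>x\<in>topspace S. u x = 0)"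
    have v: "(\<lambda>x\<in>topspace S. inverse (u x)) \<in> carrier ?A"
      using nz cont[OF u] by (intro carrierI) (auto simp: continuous_map_atin intro: tendsto_inverse)
    have "(\<lambda>x\<in>topspace S. u x * (\<lambda>x\<in>topspace S. inverse (u x)) x) = i"
      using nz by (auto simp: i_def)
    then show False using mult'[OF u v that(2)] Fi[OF that(2)] that(3) by simp
  qed
  have shift: "(\<lambda>x\<in>topspace S. f x - c) \<in> carrier ?A" "F (\<lambda>x\<in>topspace S. f x - c) t = F f t - c"
    if f: "f \<in> carrier ?A" and t: "t \<in> topspace T" for f c t
  proof -
    show "(\<lambda>x\<in>topspace S. f x - c) \<in> carrier ?A"
      using cont[OF f] by (intro carrierI continuous_map_diff) simp_all
    have ci: "(\<lambda>x\<in>topspace S. - c * i x) \<in> carrier ?A"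
      using cont[OF i] by (intro carrierI continuous_map_complex_mult) simp_all
    have "(\<lambda>x\<in>topspace S. f x - c) = (\<lambda>x\<in>topspace S. f x + (\<lambda>x\<in>topspace S. - c * i x) x)"
      by (auto simp: i_def)
    then show "F (\<lambda>x\<in>topspace S. f x - c) t = F f t - c"
      using add'[OF f ci t] smult'[OF i t, of "- c"] Fi[OF t] by simp
  qed
  text \<open>
    If \<open>f\<close> took at \<open>x\<close> another value than \<open>F f\<close> at \<open>t\<close>, then
    \<open>\<bar>e - F e t\<bar>\<^sup>2 + \<bar>f - F f t\<bar>\<^sup>2\<close> would vanish nowhere, although its image vanishes at \<open>t\<close>.
  \<close>
  have evaluation: "F f t = f x"
    if f: "f \<in> carrier ?A" and t: "t \<in> topspace T" and x: "x \<in> topspace S" "e x = F e t" for f t x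
  proof (rule ccontr)
    assume ne: "F f t \<noteq> f x"
    let ?u = "\<lambda>x\<in>topspace S. e x - F e t" and ?v = "\<lambda>x\<in>topspace S. f x - F f t"
    let ?uu = "\<lambda>x\<in>topspace S. ?u x * (\<lambda>x\<in>topspace S. cnj (?u x)) x"
    let ?vv = "\<lambda>x\<in>topspace S. ?v x * (\<lambda>x\<in>topspace S. cnj (?v x)) x"
    have cnj: "(\<lambda>x\<in>topspace S. cnj (g x)) \<in> carrier ?A" if "g \<in> carrier ?A" for g
      using cont[OF that] by (intro carrierI) (auto simp: continuous_map_atin intro: tendsto_cnj)
    have square: "(\<lambda>x\<in>topspace S. g x * (\<lambda>x\<in>topspace S. cnj (g x)) x) \<in> carrier ?A"
      if "g \<in> carrier ?A" for g
      by (rule carrierI, rule continuous_map_complex_mult; rule cont; rule that cnj[OF that])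
    have u: "?u \<in> carrier ?A" and v: "?v \<in> carrier ?A" using shift(1) e f t by auto
    have "F ?uu t = 0"
      using mult'[OF u cnj[OF u] t] shift(2)[OF e t, of "F e t"] by simp
    moreover have "F ?vv t = 0"
      using mult'[OF v cnj[OF v] t] shift(2)[OF f t, of "F f t"] by simp
    ultimately have "F (\<lambda>x\<in>topspace S. ?uu x + ?vv x) t = 0"
      using add'[OF square[OF u] square[OF v] t] by simp
    moreover have "(\<lambda>x\<in>topspace S. ?uu x + ?vv x) \<in> carrier ?A"
      by (rule carrierI, rule continuous_map_add; rule cont; rule square[OF u] square[OF v])
    ultimately obtain y where y: "y \<in> topspace S" "?uu y + ?vv y = 0"
      using nonvanishing[OF _ t] by (metis (no_types, lifting) restrict_apply')
    then have "(e y - F e t) * cnj (e y - F e t) + (f y - F f t) * cnj (f y - F f t) = 0"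
      by simp
    then have "of_real ((cmod (e y - F e t))\<^sup>2 + (cmod (f y - F f t))\<^sup>2) = (0::complex)"
      by (simp only: of_real_add complex_norm_square)
    then have "(cmod (e y - F e t))\<^sup>2 + (cmod (f y - F f t))\<^sup>2 = 0"
      unfolding of_real_eq_0_iff .
    then have "e y = F e t" "f y = F f t" by (simp_all add: sum_power2_eq_zero_iff)
    moreover have "y = x" using inj_onD[OF inj _ y(1) x(1)] \<open>e y = F e t\<close> x(2) by simp
    ultimately show False using ne by simp
  qed
  \<comment> \<open>The image of \<open>e - F e p\<close> vanishes at \<open>p\<close>, so
    \<open>e\<close> must attain the value \<open>F e p\<close>.\<close>
  have "\<exists>x\<in>topspace S. (\<lambda>x\<in>topspace S. e x - F e p) x = 0"
    using nonvanishing[OF shift(1)[OF e p] p] shift(2)[OF e p, of "F e p"] by (simp only: diff_self)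
  then obtain x where x: "x \<in> topspace S" "e x = F e p" by auto
  obtain g where g: "g \<in> carrier ?B" "g p \<noteq> g q" using sep p q \<open>p \<noteq> q\<close> by blast
  from surj[OF g(1)] obtain f where f: "f \<in> carrier ?A" "F f = g" by blast
  show False
    using evaluation[OF f(1) p x] evaluation[OF f(1) q x(1)] x(2) eq f(2) g(2) by simp
qed

section \<open>The cylinder as an annulus, and functions separating the points of the strip\<close>

lemma equivclp_cylinder: "equivclp cylinder_rel p q \<longleftrightarrow> p = q \<or> cylinder_rel p q \<or> cylinder_rel q p"
  by (rule equivclp_matching) auto

lemma equivclp_moebius: "equivclp moebius_rel p q \<longleftrightarrow> p = q \<or> moebius_rel p q \<or> moebius_rel q p"
  by (rule equivclp_matching) auto

lemma cis_two_pi_eq: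
  assumes "x \<in> {0..1}" "x' \<in> {0..1}" "cis (2 * pi * x) = cis (2 * pi * x')"
  shows "x = x' \<or> (x = 0 \<and> x' = 1) \<or> (x = 1 \<and> x' = 0)"
proof -
  have "sin (2 * pi * x) = sin (2 * pi * x') \<and> cos (2 * pi * x) = cos (2 * pi * x')"
    using assms(3) by (simp add: complex_eq_iff)
  then obtain n :: int where "2 * pi * x = 2 * pi * x' + 2 * pi * n"
    unfolding sin_cos_eq_iff by blast
  then have "2 * pi * x = 2 * pi * (x' + n)" by (simp add: algebra_simps)
  then have n: "x = x' + n" by simp
  then have "real_of_int n \<le> 1" "real_of_int n \<ge> -1" using assms(1,2) by auto
  then have "n = -1 \<or> n = 0 \<or> n = 1" by linarith
  then show ?thesis using n assms(1,2) by auto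
qed

lemma cylinder_planar:
  obtains e where "e \<in> carrier (continuous_functions cylinder)" "inj_on e (topspace cylinder)"
proof -
  \<comment> \<open>An annulus with radii from 1 to 2: the modulus recovers \<open>y\<close>, and
    the argument recovers \<open>x\<close> up to the gluing.\<close>
  let ?u = "\<lambda>p. of_real (1 + snd p) * cis (2 * pi * fst p)"
  have "continuous_map unit_square euclidean ?u"
    by (auto simp: cis_conv_exp intro!: continuous_intros)
  then have "\<exists>e\<in>carrier (continuous_functions cylinder).
      \<forall>p\<in>topspace unit_square. e (quotient_class unit_square cylinder_rel p) = ?u p"
    unfolding cylinder_def by (rule quotient_function) auto
  then obtain e where e: "e \<in> carrier (continuous_functions cylinder)"
    "\<And>p. p \<in> topspace unit_square \<Longrightarrow> e (quotient_class unit_square cylinder_rel p) = ?u p"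
    by blast
  have "inj_on e (topspace cylinder)"
    unfolding cylinder_def topspace_quotient_space
  proof (intro inj_onI, clarsimp)
    fix x y x' y' :: real
    assume xy: "0 \<le> x" "x \<le> 1" "0 \<le> y" "y \<le> 1" "0 \<le> x'" "x' \<le> 1" "0 \<le> y'" "y' \<le> 1"
      and eq: "e (quotient_class unit_square cylinder_rel (x, y)) =
        e (quotient_class unit_square cylinder_rel (x', y'))"
    have u: "?u (x, y) = ?u (x', y')" using e(2)[of "(x, y)"] e(2)[of "(x', y')"] xy eq by simp
    then have "cmod (?u (x, y)) = cmod (?u (x', y'))" by (rule arg_cong)
    then have "y = y'" using xy by (simp add: norm_mult del: of_real_add)
    moreover have "cis (2 * pi * x) = cis (2 * pi * x')"
    proof -
      have "complex_of_real (1 + y) \<noteq> 0" using xy by (simp del: of_real_add)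
      then show ?thesis using u \<open>y = y'\<close> by simp
    qed
    then have "x = x' \<or> (x = 0 \<and> x' = 1) \<or> (x = 1 \<and> x' = 0)"
      using xy by (intro cis_two_pi_eq) auto
    ultimately have "equivclp cylinder_rel (x, y) (x', y')"
      unfolding equivclp_cylinder using xy by auto
    then show "quotient_class unit_square cylinder_rel (x, y) =
        quotient_class unit_square cylinder_rel (x', y')"
      using xy by (subst quotient_class_eq_iff) auto
  qed
  with e(1) show ?thesis by (rule that)
qed

lemma moebius_separated:
  assumes "p \<in> topspace moebius_strip" "q \<in> topspace moebius_strip" "p \<noteq> q"
  shows "\<exists>f\<in>carrier (continuous_functions moebius_strip). f p \<noteq> f q"
proof (rule ccontr)
  assume contra: "\<not> ?thesis"
  let ?c = "quotient_class unit_square moebius_rel"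
  obtain x y x' y' where xy: "x \<in> {0..1}" "y \<in> {0..1}" "x' \<in> {0..1}" "y' \<in> {0..1}"
    and p: "p = ?c (x, y)" and q: "q = ?c (x', y')"
    using assms(1,2) unfolding moebius_strip_def topspace_quotient_space by auto
  \<comment> \<open>A function respecting the gluing descends to the strip, where by assumption it
    does not separate \<open>p\<close> and \<open>q\<close>.\<close>
  have same: "u (x, y) = u (x', y')"
    if u: "continuous_map unit_square euclidean u" "\<And>p q. moebius_rel p q \<Longrightarrow> u p = u q"
    for u :: "real \<times> real \<Rightarrow> complex"
  proof -
    from quotient_function[of unit_square u moebius_rel, OF u]
    obtain f where f: "f \<in> carrier (continuous_functions moebius_strip)"
      "\<forall>p\<in>topspace unit_square. f (?c p) = u p"
      unfolding moebius_strip_def[symmetric] by (rule bexE)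
    have "f p = f q" using contra f(1) by blast
    then show ?thesis using bspec[OF f(2), of "(x, y)"] bspec[OF f(2), of "(x', y')"] xy p q by simp
  qed
  have "continuous_map unit_square euclidean (\<lambda>p. cis (2 * pi * fst p))"
    by (auto simp: cis_conv_exp intro!: continuous_intros)
  from same[OF this] have "cis (2 * pi * x) = cis (2 * pi * x')" by auto
  then have x: "x = x' \<or> (x = 0 \<and> x' = 1) \<or> (x = 1 \<and> x' = 0)"
    using xy by (intro cis_two_pi_eq) auto
  \<comment> \<open>The gluing reverses the sign of \<open>y - 1/2\<close>, and the half turn of
    \<open>cis (pi * x)\<close> from \<open>x = 0\<close> to \<open>x = 1\<close> makes up for
    it.\<close>
  have "continuous_map unit_square euclidean (\<lambda>p. of_real (snd p - 1/2) * cis (pi * fst p))"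
    by (auto simp: cis_conv_exp intro!: continuous_intros)
  from same[OF this] have y: "of_real (y - 1/2) * cis (pi * x) = of_real (y' - 1/2) * cis (pi * x')"
    by (auto simp: complex_eq_iff)
  have "y = y'" if "x = x'" using y that by simp
  moreover have "y' = 1 - y" if "x = 0 \<and> x' = 1 \<or> x = 1 \<and> x' = 0"
    using y that by (auto simp: complex_eq_iff)
  ultimately have "equivclp moebius_rel (x, y) (x', y')"
    unfolding equivclp_moebius using x xy by auto
  then have "p = q" unfolding p q using xy by (subst quotient_class_eq_iff) auto
  then show False using assms(3) by simp
qed

text \<open>
  The core of the Moebius strip would become a Jordan curve.  The rest of the strip is connected and
  so lies on one side of the curve, but near a point of the core the strip fills a neighbourhood.
\<close>

lemma moebius_not_planar:
  assumes "continuous_map moebius_strip euclidean (g :: _ \<Rightarrow> complex)"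
  shows "\<not> inj_on g (topspace moebius_strip)"
proof
  assume inj: "inj_on g (topspace moebius_strip)"
  define G where "G = g \<circ> quotient_class unit_square moebius_rel"
  have "continuous_map unit_square euclidean G"
    unfolding G_def using assms unfolding moebius_strip_def
    by (rule continuous_map_compose[OF quotient_imp_continuous_map[OF quotient_map_quotient_class]])
  then have contG: "continuous_on unit_interval_square G" by simp
  have G_eq: "p = q \<or> moebius_rel p q \<or> moebius_rel q p"
    if "p \<in> unit_interval_square" "q \<in> unit_interval_square" "G p = G q" for p q
  proof -
    have "quotient_class unit_square moebius_rel p = quotient_class unit_square moebius_rel q"
      using that inj unfolding G_def moebius_strip_def topspace_quotient_space by (auto dest: inj_onD)
    then have "equivclp moebius_rel p q" using that by (subst (asm) quotient_class_eq_iff) auto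
    then show ?thesis by (simp only: equivclp_moebius)
  qed
  have glue: "G (0, y) = G (1, 1 - y)" if "y \<in> {0..1}" for y
  proof -
    have "equivclp moebius_rel (0, y) (1, 1 - y)" unfolding equivclp_moebius using that by auto
    then have "quotient_class unit_square moebius_rel (0, y) =
        quotient_class unit_square moebius_rel (1, 1 - y)"
      using that by (subst quotient_class_eq_iff) auto
    then show ?thesis by (simp add: G_def)
  qed

  \<comment> \<open>The core closes up after one turn, because replacing \<open>y\<close> by
    \<open>1 - y\<close> fixes the midpoint.\<close>
  define c where "c t = G (t, 1/2)" for t
  have "simple_path c"
    unfolding simple_path_def loop_free_def path_def
  proof (intro conjI ballI impI)
    show "continuous_on {0..1} c"
      unfolding c_def by (rule continuous_on_compose2[OF contG]) (auto intro!: continuous_intros)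
    show "s = t \<or> s = 0 \<and> t = 1 \<or> s = 1 \<and> t = 0" if "s \<in> {0..1}" "t \<in> {0..1}" "c s = c t" for s t
      using G_eq[of "(s, 1/2)" "(t, 1/2)"] that by (auto simp: c_def)
  qed
  moreover have "pathfinish c = pathstart c"
    using glue[of "1/2"] by (simp add: c_def pathfinish_def pathstart_def)
  ultimately obtain inner outer where jordan: "open inner" "open outer" "inner \<inter> outer = {}"
    "inner \<union> outer = - path_image c" "frontier inner = path_image c" "frontier outer = path_image c"
    by (rule Jordan_curve)

  \<comment> \<open>The strip without its core: two connected halves that share the image of the
    glued corners \<open>(0, 0)\<close> and \<open>(1, 1)\<close>. This is where the twist
    enters.\<close>
  define V where "V = G ` ({0..1} \<times> {0..<1/2}) \<union> G ` ({0..1} \<times> {1/2<..1})"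
  have "connected (G ` ({0..1} \<times> {0..<1/2}))" "connected (G ` ({0..1} \<times> {1/2<..1}))"
    by (auto intro!: connected_continuous_image continuous_on_subset[OF contG] connected_Times)
  moreover have "G ` ({0..1} \<times> {0..<1/2}) \<inter> G ` ({0..1} \<times> {1/2<..1}) \<noteq> {}"
  proof -
    have "G (0, 0) \<in> G ` ({0..1} \<times> {0..<1/2})" by auto
    moreover have "G (1, 1) \<in> G ` ({0..1} \<times> {1/2<..1})" by auto
    moreover have "G (0, 0) = G (1, 1)" using glue[of 0] by simp
    ultimately show ?thesis by (metis disjoint_iff)
  qed
  ultimately have "connected V" unfolding V_def by (rule connected_Un)
  moreover have "V \<inter> path_image c = {}"
  proof (rule equals0I)
    fix z assume z: "z \<in> V \<inter> path_image c"
    then obtain t where t: "t \<in> {0..1}" "z = G (t, 1/2)" by (auto simp: path_image_def c_def)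
    have "\<exists>p\<in>unit_interval_square. snd p \<noteq> 1/2 \<and> z = G p"
      using IntD1[OF z] unfolding V_def by (elim UnE imageE; intro bexI conjI) auto
    then obtain p where p: "p \<in> unit_interval_square" "snd p \<noteq> 1/2" "z = G p" by blast
    show False using G_eq[of p "(t, 1/2)"] p t by auto
  qed
  ultimately have one_side: "inner \<inter> V = {} \<or> outer \<inter> V = {}"
    using jordan by (intro connectedD) auto

  \<comment> \<open>The open square is placed in the complex plane, so that invariance of domain
    applies to \<open>G\<close> on it.\<close>
  define U where "U = {z. 0 < Re z \<and> Re z < 1 \<and> 0 < Im z \<and> Im z < 1}"
  define N where "N = (\<lambda>z. G (Re z, Im z)) ` U"
  have "open N"
    unfolding N_def
  proof (rule invariance_of_domain)
    show "continuous_on U (\<lambda>z. G (Re z, Im z))"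
      by (rule continuous_on_compose2[OF contG]) (auto intro!: continuous_intros simp: U_def)
    show "open U"
      unfolding U_def by (intro open_Collect_conj open_Collect_less continuous_intros)
    show "inj_on (\<lambda>z. G (Re z, Im z)) U"
    proof (rule inj_onI)
      fix z w assume "z \<in> U" "w \<in> U" "G (Re z, Im z) = G (Re w, Im w)"
      then show "z = w"
        using G_eq[of "(Re z, Im z)" "(Re w, Im w)"] by (auto simp: U_def complex_eq_iff)
    qed
  qed
  have "N \<subseteq> V \<union> path_image c"
  proof -
    have "G (x, y) \<in> V \<union> path_image c" if "0 < x" "x < 1" "0 < y" "y < 1" for x y
    proof (cases y "1/2 :: real" rule: linorder_cases)
      case equal
      have "G (x, y) = c x" by (simp only: c_def equal)
      then show ?thesis using that by (auto simp: path_image_def)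
    qed (use that in \<open>auto simp: V_def\<close>)
    then show ?thesis by (auto simp: N_def U_def)
  qed
  moreover have "c (1/2) \<in> N"
    unfolding N_def U_def c_def by (rule image_eqI[of _ _ "Complex (1/2) (1/2)"]) auto
  moreover have "c (1/2) \<in> path_image c" by (auto simp: path_image_def)
  ultimately have "inner \<inter> V \<noteq> {}" "outer \<inter> V \<noteq> {}"
  proof -
    \<comment> \<open>The core point \<open>c (1/2)\<close> is on the frontier of \<open>W\<close>,
      so its neighbourhood \<open>N\<close> meets \<open>W\<close>; away from the curve,
      \<open>N\<close> lies in \<open>V\<close>.\<close>
    have meets: "W \<inter> V \<noteq> {}" if "frontier W = path_image c" "W \<inter> path_image c = {}" for W
    proof -
      have "c (1/2) \<in> closure W" using that(1) \<open>c (1/2) \<in> path_image c\<close> by (auto simp: frontier_def)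
      then have "N \<inter> W \<noteq> {}"
        using open_Int_closure_eq_empty[OF \<open>open N\<close>, of W] \<open>c (1/2) \<in> N\<close> by auto
      then show ?thesis using \<open>N \<subseteq> V \<union> path_image c\<close> that(2) by blast
    qed
    have "inner \<inter> path_image c = {}" "outer \<inter> path_image c = {}" using jordan(4) by blast+
    then show "inner \<inter> V \<noteq> {}" "outer \<inter> V \<noteq> {}" using jordan(5,6) by (simp_all add: meets)
  qed
  with one_side show False by blast
qed

theorem mainTheorem1:
  shows "\<not> algebras_isomorphic (continuous_functions cylinder) (continuous_functions moebius_strip) \<and>
    naturally_isomorphic (loday (continuous_functions cylinder))
      (loday (continuous_functions moebius_strip))"
proof (intro conjI notI naturally_isomorphic_cylinder_moebius)
  assume "algebras_isomorphic (continuous_functions cylinder) (continuous_functions moebius_strip)"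
  then obtain F where F: "F \<in> linear_isos (continuous_functions cylinder) (continuous_functions moebius_strip)"
    and mult: "\<And>f g. f \<in> carrier (continuous_functions cylinder) \<Longrightarrow>
      g \<in> carrier (continuous_functions cylinder) \<Longrightarrow>
      F (f \<otimes>\<^bsub>continuous_functions cylinder\<^esub> g) = F f \<otimes>\<^bsub>continuous_functions moebius_strip\<^esub> F g"
    by (auto simp: algebras_isomorphic_def)
  obtain e where e: "e \<in> carrier (continuous_functions cylinder)" "inj_on e (topspace cylinder)"
    by (rule cylinder_planar)
  have "inj_on (F e) (topspace moebius_strip)"
    using F mult e moebius_separated by (rule algebra_iso_injective)
  moreover have "F e \<in> carrier (continuous_functions moebius_strip)"
  proof -
    have "F \<in> linear_maps (continuous_functions cylinder) (continuous_functions moebius_strip)"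
      using F by (simp add: linear_isos_def)
    then show ?thesis using e(1) by (rule linear_maps_closed)
  qed
  ultimately show False
    using moebius_not_planar by (simp add: carrier_continuous_functions)
qed

end
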